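(* Let $X$ be a normed space of countably infinite dimension. Then $X$ admits an equivalent norm $|||\cdot|||$ such that $(X,|||\cdot|||)$ is polyhedral and the set of strongly exposed points of the unit ball of $(X,|||\cdot|||)$ is dense in the unit sphere of $(X,|||\cdot|||)$.
   Context: All normed spaces are real. The dimension of a normed space is the algebraic dimension, i.e. the cardinality of an algebraic (Hamel) basis. A normed space is polyhedral (= (K)-polyhedral) if the unit ball of every finite-dimensional subspace is a polytope (the convex hull of finitely many points). A point $x\in C$ is a strongly exposed point of a convex set $C\subseteq X$ if there is $f\in X^*$ with $f(y)<f(x)$ for all $y\in C$, $y\neq x$, and such that $y_n\to x$ in norm for every sequence $(y_n)$ in $C$ with $f(y_n)\to f(x)$. *)

theory Defs
  imports "HOL-Analysis.Analysis"
begin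

text \<open>The norm of a space is fixed by its type class, so a renorming is represented by a function
  \<open>N :: 'a \<Rightarrow> real\<close> on the same vector space; the notions below are all relative to \<open>N\<close>.\<close>

definition is_norm :: "('a::real_vector \<Rightarrow> real) \<Rightarrow> bool" where
  "is_norm N \<longleftrightarrow>
     (\<forall>x. 0 \<le> N x) \<and>
     (\<forall>x. N x = 0 \<longleftrightarrow> x = 0) \<and>
     (\<forall>x y. N (x + y) \<le> N x + N y) \<and>
     (\<forall>a x. N (a *\<^sub>R x) = \<bar>a\<bar> * N x)"

definition equivalent_norm :: "('a::real_normed_vector \<Rightarrow> real) \<Rightarrow> bool" where
  "equivalent_norm N \<longleftrightarrow>
     is_norm N \<and> (\<exists>c>0. \<exists>C>0. \<forall>x. c * norm x \<le> N x \<and> N x \<le> C * norm x)"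

definition unit_ball :: "('a::real_vector \<Rightarrow> real) \<Rightarrow> 'a set" where
  "unit_ball N = {x. N x \<le> 1}"

definition unit_sphere :: "('a::real_vector \<Rightarrow> real) \<Rightarrow> 'a set" where
  "unit_sphere N = {x. N x = 1}"

text \<open>\<open>span F\<close> with \<open>F\<close> finite ranges over exactly the finite-dimensional subspaces.\<close>

definition polyhedral_norm :: "('a::real_vector \<Rightarrow> real) \<Rightarrow> bool" where
  "polyhedral_norm N \<longleftrightarrow> (\<forall>F. finite F \<longrightarrow> polytope (unit_ball N \<inter> span F))"

definition dual_space :: "('a::real_vector \<Rightarrow> real) \<Rightarrow> ('a \<Rightarrow> real) set" where
  "dual_space N = {f. linear f \<and> (\<exists>K. \<forall>x. \<bar>f x\<bar> \<le> K * N x)}"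

definition strongly_exposed_point ::
    "('a::real_vector \<Rightarrow> real) \<Rightarrow> 'a set \<Rightarrow> 'a \<Rightarrow> bool" where
  "strongly_exposed_point N C x \<longleftrightarrow>
     x \<in> C \<and>
     (\<exists>f\<in>dual_space N.
        (\<forall>y\<in>C. y \<noteq> x \<longrightarrow> f y < f x) \<and>
        (\<forall>y. (\<forall>n::nat. y n \<in> C) \<longrightarrow> (\<lambda>n. f (y n)) \<longlonglongrightarrow> f x \<longrightarrow>
             (\<lambda>n. N (y n - x)) \<longlonglongrightarrow> 0))"

definition norm_dense_in ::
    "('a::real_vector \<Rightarrow> real) \<Rightarrow> 'a set \<Rightarrow> 'a set \<Rightarrow> bool" where
  "norm_dense_in N A S \<longleftrightarrow>
     A \<subseteq> S \<and> (\<forall>x\<in>S. \<forall>\<epsilon>>0. \<exists>y\<in>A. N (y - x) < \<epsilon>)"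

text \<open>Hamel dimension \<open>\<aleph>\<^sub>0\<close>. The library function \<open>dim\<close> is natural-valued and returns 0 on
  infinite-dimensional spaces, so it cannot be used here.\<close>

definition countably_infinite_dimensional :: "'a::real_vector itself \<Rightarrow> bool" where
  "countably_infinite_dimensional _ \<longleftrightarrow>
     (\<exists>B::'a set. independent B \<and> span B = UNIV \<and> countable B \<and> infinite B)"

end

theory Submission
  imports Defs
begin

text \<open>
  Let \<open>E\<^sub>0 \<subset> E\<^sub>1 \<subset> ...\<close> be the spans of the initial segments of a countable Hamel basis. A function on the
  space that is changed infinitely often, but only finitely often on each \<open>E\<^sub>n\<close>, has a limit whose
  restriction to each \<open>E\<^sub>n\<close> is reached after finitely many changes
  (\<open>glue_along_exhaustion\<close>). Polyhedrality concerns only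
  finite-dimensional subspaces, so it survives such a limit; it is recorded as the property of
  being, on each finite-dimensional subspace, a maximum of finitely many absolute values of linear
  functionals, which gives polytopes by \<open>polytope_unit_ball_max_of_functionals\<close>.

  A first polyhedral norm \<open>N\<^sub>0\<close> is the supremum of functionals that almost norm \<open>E\<^sub>n\<close>, weighted
  by factors decreasing to 1, so that the later functionals do not count on \<open>E\<^sub>n\<close>
  (\<open>polyhedral_base_norm\<close>).

  Then strongly exposed points are added one at a time. At step \<open>k\<close>, given the polyhedral norm \<open>N\<^sub>k\<close>
  with ball \<open>B\<^sub>k\<close>, pick any point \<open>v\<close> of its sphere in \<open>E\<^bsub>k+1\<^esub>\<close> but outside \<open>E\<^sub>k\<close>, and let \<open>g\<close>
  support \<open>B\<^sub>k\<close> at \<open>v\<close>. Tilting \<open>g\<close> slightly by a functional that vanishes on \<open>E\<^sub>k\<close> gives \<open>f\<close> with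
  \<open>f v = 1\<close>, with \<open>f\<close> strictly less than 1 on the ball of \<open>E\<^sub>k\<close>, and with \<open>f\<close> only slightly above 1 on
  \<open>B\<^sub>k\<close>. Hence for small \<open>c\<close> the double cone of all \<open>x\<close> with
  \<open>\<bar>f x\<bar> + c * N\<^sub>k (x - f x *\<^sub>R v) \<le> 1\<close> contains the ball of \<open>E\<^sub>k\<close> and nearly all of \<open>B\<^sub>k\<close>
  (\<open>exposing_functional\<close>), and it is polyhedral because \<open>N\<^sub>k\<close> is. Let \<open>B\<^bsub>k+1\<^esub>\<close> be the intersection of
  \<open>B\<^sub>k\<close> with this cone. Being an apex of the cone, \<open>v\<close> is strongly exposed in \<open>B\<^bsub>k+1\<^esub>\<close>, and
  it remains so in all smaller balls that contain it; and it stays in them, because later steps do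
  not change the norm on \<open>E\<^bsub>k+1\<^esub>\<close>. The only freedom used is that \<open>v\<close> can be chosen near
  any prescribed point of the sphere of \<open>E\<^sub>k\<close>. Letting these targets run through a dense set, with each member
  recurring infinitely often, makes the strongly exposed points dense in the limit. The losses at
  the steps are chosen so small that all norms stay between the original norm and three times it.
\<close>

section \<open>Maxima of finitely many functionals and polytopes\<close>

text \<open>
  This is the form in which polyhedrality is carried through the constructions below. On a
  finite-dimensional subspace it is the dual description of a polytope (finitely many pairs of
  parallel faces), and unlike the list of vertices it survives taking maxima and composing with
  linear maps. It is stated for an arbitrary function \<open>N\<close>, because it already makes \<open>N\<close> a seminorm
  on a subspace \<open>S\<close>.
\<close>

definition max_of_functionals_on :: "'a::real_vector set \<Rightarrow> ('a \<Rightarrow> real) \<Rightarrow> bool" where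
  "max_of_functionals_on S N \<longleftrightarrow>
     (\<exists>\<Phi>. finite \<Phi> \<and> (\<forall>\<phi>\<in>\<Phi>. linear \<phi>) \<and>
          (\<forall>x\<in>S. (\<forall>\<phi>\<in>\<Phi>. \<bar>\<phi> x\<bar> \<le> N x) \<and> (\<exists>\<phi>\<in>\<Phi>. N x = \<bar>\<phi> x\<bar>)))"

text \<open>
  Starting at a point \<open>x\<close> of the set \<open>\<bar>\<phi>\<bar> \<le> 1\<close> and moving in a direction \<open>y\<close> that does not disturb
  the constraints active at \<open>x\<close>, one must hit a new constraint, since some \<open>\<phi>\<close> is not constant in that
  direction. The first one hit is added to the active set.
\<close>

lemma activate_constraint:
  fixes \<Phi> :: "('a::real_vector \<Rightarrow> real) set"
  assumes fin: "finite \<Phi>" and lin: "\<And>\<phi>. \<phi> \<in> \<Phi> \<Longrightarrow> linear \<phi>"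
    and bnd: "\<And>\<phi>. \<phi> \<in> \<Phi> \<Longrightarrow> \<bar>\<phi> x\<bar> \<le> 1"
    and act: "\<And>\<phi>. \<phi> \<in> \<Phi> \<Longrightarrow> \<bar>\<phi> x\<bar> = 1 \<Longrightarrow> \<phi> y = 0"
    and ex: "\<exists>\<phi>\<in>\<Phi>. \<phi> y \<noteq> 0"
  obtains t where "t > 0" "\<And>\<phi>. \<phi> \<in> \<Phi> \<Longrightarrow> \<bar>\<phi> (x + t *\<^sub>R y)\<bar> \<le> 1"
    "{\<phi>\<in>\<Phi>. \<bar>\<phi> x\<bar> = 1} \<subset> {\<phi>\<in>\<Phi>. \<bar>\<phi> (x + t *\<^sub>R y)\<bar> = 1}"
proof -
  define T where "T = {\<phi>\<in>\<Phi>. \<phi> y \<noteq> 0}"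
  \<comment> \<open>the time at which the constraint \<open>\<phi>\<close> becomes active along the ray\<close>
  define w where "w \<phi> = (1 - sgn (\<phi> y) * \<phi> x) / \<bar>\<phi> y\<bar>" for \<phi> :: "'a \<Rightarrow> real"
  define t where "t = Min (w ` T)"
  have T: "finite T" "T \<noteq> {}" using fin ex by (auto simp: T_def)
  have ev: "\<phi> (x + s *\<^sub>R y) = \<phi> x + s * \<phi> y" if "\<phi> \<in> \<Phi>" for \<phi> s
    using lin[OF that] by (simp add: linear_add linear_cmul)
  have lt1: "\<bar>\<phi> x\<bar> < 1" if "\<phi> \<in> T" for \<phi>
    using bnd[of \<phi>] act[of \<phi>] that by (force simp: T_def)
  have wpos: "w \<phi> > 0" if "\<phi> \<in> T" for \<phi>
  proof -
    have "\<phi> y \<noteq> 0" using that by (simp add: T_def)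
    then show ?thesis using lt1[OF that]
      by (cases "\<phi> y > 0") (auto simp: w_def sgn_if abs_less_iff divide_less_0_iff)
  qed
  have tpos: "t > 0" unfolding t_def using T wpos by simp
  obtain \<psi> where \<psi>: "\<psi> \<in> T" "t = w \<psi>"
    using Min_in[of "w ` T"] T unfolding t_def by blast
  have val: "\<bar>\<phi> x + s * \<phi> y\<bar> \<le> 1" if "\<phi> \<in> T" "0 \<le> s" "s \<le> w \<phi>" for \<phi> s
  proof -
    have ne: "\<phi> y \<noteq> 0" using that by (simp add: T_def)
    have "s * \<bar>\<phi> y\<bar> \<le> 1 - sgn (\<phi> y) * \<phi> x"
      using that(3) ne by (simp add: w_def pos_le_divide_eq)
    moreover have "0 \<le> s * \<bar>\<phi> y\<bar>" using that(2) by simp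
    ultimately show ?thesis using lt1[OF that(1)] ne
      by (cases "\<phi> y > 0") (auto simp: sgn_if abs_if split: if_splits)
  qed
  have bnd': "\<bar>\<phi> (x + t *\<^sub>R y)\<bar> \<le> 1" if "\<phi> \<in> \<Phi>" for \<phi>
  proof (cases "\<phi> \<in> T")
    case True
    have "t \<le> w \<phi>" unfolding t_def using T True by simp
    then show ?thesis using val[OF True] tpos ev[OF that] by simp
  next
    case False
    then show ?thesis using bnd[OF that] ev[OF that] that by (simp add: T_def)
  qed
  have \<psi>': "\<psi> \<in> \<Phi>" "\<psi> y \<noteq> 0" using \<psi> by (auto simp: T_def)
  have "\<bar>\<psi> x + t * \<psi> y\<bar> = 1"
    using \<psi>'(2) unfolding \<psi>(2) w_def by (auto simp: sgn_if abs_if)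
  then have "\<psi> \<in> {\<phi>\<in>\<Phi>. \<bar>\<phi> (x + t *\<^sub>R y)\<bar> = 1}" using \<psi>' ev by simp
  moreover have "\<psi> \<notin> {\<phi>\<in>\<Phi>. \<bar>\<phi> x\<bar> = 1}" using lt1[OF \<psi>(1)] by simp
  moreover have "{\<phi>\<in>\<Phi>. \<bar>\<phi> x\<bar> = 1} \<subseteq> {\<phi>\<in>\<Phi>. \<bar>\<phi> (x + t *\<^sub>R y)\<bar> = 1}"
  proof
    fix \<phi> assume "\<phi> \<in> {\<phi>\<in>\<Phi>. \<bar>\<phi> x\<bar> = 1}"
    then show "\<phi> \<in> {\<phi>\<in>\<Phi>. \<bar>\<phi> (x + t *\<^sub>R y)\<bar> = 1}"
      using act[of \<phi>] ev[of \<phi> t] by simp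
  qed
  ultimately have "{\<phi>\<in>\<Phi>. \<bar>\<phi> x\<bar> = 1} \<subset> {\<phi>\<in>\<Phi>. \<bar>\<phi> (x + t *\<^sub>R y)\<bar> = 1}" by blast
  then show ?thesis using that tpos bnd' by blast
qed

text \<open>
  Points at which the active constraints determine the point form a finite set \<open>V\<close>, because each
  is determined by the signs of its active constraints. Any other point has a direction that leaves the
  active constraints fixed; by the previous lemma it can be moved both ways along it, and so lies
  between two points with more active constraints. Induction on the number of inactive
  constraints puts it into the hull of \<open>V\<close>.
\<close>

lemma polytope_bounded_constraints:
  fixes \<Phi> :: "('a::real_vector \<Rightarrow> real) set"
  assumes S: "subspace S" and fin: "finite \<Phi>" and lin: "\<And>\<phi>. \<phi> \<in> \<Phi> \<Longrightarrow> linear \<phi>"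
    and sep: "\<And>x. x \<in> S \<Longrightarrow> \<forall>\<phi>\<in>\<Phi>. \<phi> x = 0 \<Longrightarrow> x = 0"
  shows "polytope {x\<in>S. \<forall>\<phi>\<in>\<Phi>. \<bar>\<phi> x\<bar> \<le> 1}"
proof -
  define P where "P = {x\<in>S. \<forall>\<phi>\<in>\<Phi>. \<bar>\<phi> x\<bar> \<le> 1}"
  define A where "A x = {\<phi>\<in>\<Phi>. \<bar>\<phi> x\<bar> = 1}" for x
  define V where "V = {x\<in>P. \<forall>y\<in>S. (\<forall>\<phi>\<in>A x. \<phi> y = 0) \<longrightarrow> y = 0}"
  have "finite V"
  proof (rule inj_on_finite)
    let ?g = "\<lambda>x. ({\<phi>\<in>\<Phi>. \<phi> x = 1}, {\<phi>\<in>\<Phi>. \<phi> x = -1})"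
    show "inj_on ?g V"
    proof (rule inj_onI)
      fix x y assume xy: "x \<in> V" "y \<in> V" "?g x = ?g y"
      have "x - y \<in> S" using xy S by (simp add: V_def P_def subspace_diff)
      moreover have "\<phi> (x - y) = 0" if "\<phi> \<in> A x" for \<phi>
      proof -
        have "\<phi> \<in> \<Phi>" "\<phi> x = 1 \<or> \<phi> x = -1" using that by (auto simp: A_def)
        moreover have "\<phi> x = 1 \<longleftrightarrow> \<phi> y = 1" "\<phi> x = -1 \<longleftrightarrow> \<phi> y = -1"
          using xy(3) \<open>\<phi> \<in> \<Phi>\<close> by auto
        ultimately show ?thesis using linear_diff[OF lin[OF \<open>\<phi> \<in> \<Phi>\<close>], of x y] by auto
      qed
      ultimately have "x - y = 0" using xy(1) by (auto simp: V_def)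
      then show "x = y" by simp
    qed
    show "?g ` V \<subseteq> Pow \<Phi> \<times> Pow \<Phi>" by auto
    show "finite (Pow \<Phi> \<times> Pow \<Phi>)" using fin by simp
  qed
  moreover have "P = convex hull V"
  proof
    have "convex P"
    proof (rule convexI)
      fix x y :: 'a and u v :: real
      assume h: "x \<in> P" "y \<in> P" "0 \<le> u" "0 \<le> v" "u + v = 1"
      have "u *\<^sub>R x + v *\<^sub>R y \<in> S"
        using h S by (simp add: P_def subspace_add subspace_scale)
      moreover have "\<bar>\<phi> (u *\<^sub>R x + v *\<^sub>R y)\<bar> \<le> 1" if "\<phi> \<in> \<Phi>" for \<phi>
      proof -
        have "\<phi> (u *\<^sub>R x + v *\<^sub>R y) = u * \<phi> x + v * \<phi> y"
          using lin[OF that] by (simp add: linear_add linear_cmul)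
        moreover have "\<bar>u * \<phi> x + v * \<phi> y\<bar> \<le> u * \<bar>\<phi> x\<bar> + v * \<bar>\<phi> y\<bar>"
          using h abs_triangle_ineq[of "u * \<phi> x" "v * \<phi> y"] by (simp add: abs_mult)
        moreover have "u * \<bar>\<phi> x\<bar> + v * \<bar>\<phi> y\<bar> \<le> u * 1 + v * 1"
          using h that by (intro add_mono mult_left_mono) (auto simp: P_def)
        ultimately show ?thesis using h by simp
      qed
      ultimately show "u *\<^sub>R x + v *\<^sub>R y \<in> P" by (simp add: P_def)
    qed
    then show "convex hull V \<subseteq> P" by (intro hull_minimal) (auto simp: V_def)
    have "x \<in> convex hull V" if "x \<in> P" for x
      using that
    proof (induction "card (\<Phi> - A x)" arbitrary: x rule: less_induct)
      case less
      show ?case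
      proof (cases "x \<in> V")
        case True
        then show ?thesis by (simp add: hull_inc)
      next
        case False
        then obtain y where y: "y \<in> S" "\<And>\<phi>. \<phi> \<in> A x \<Longrightarrow> \<phi> y = 0" "y \<noteq> 0"
          using less.prems by (auto simp: V_def)
        have step: "\<exists>t>0. x + t *\<^sub>R z \<in> convex hull V"
          if z: "z \<in> S" "\<And>\<phi>. \<phi> \<in> A x \<Longrightarrow> \<phi> z = 0" "z \<noteq> 0" for z
        proof -
          have "\<exists>\<phi>\<in>\<Phi>. \<phi> z \<noteq> 0" using sep[OF z(1)] z(3) by blast
          then obtain t where t: "t > 0" "\<And>\<phi>. \<phi> \<in> \<Phi> \<Longrightarrow> \<bar>\<phi> (x + t *\<^sub>R z)\<bar> \<le> 1"
            "A x \<subset> A (x + t *\<^sub>R z)"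
            using activate_constraint[OF fin lin, of x z] less.prems z(2)
            unfolding A_def P_def by blast
          have "x + t *\<^sub>R z \<in> P"
            using t(2) less.prems z(1) S by (simp add: P_def subspace_add subspace_scale)
          moreover have "card (\<Phi> - A (x + t *\<^sub>R z)) < card (\<Phi> - A x)"
            using t(3) fin by (intro psubset_card_mono) (auto simp: A_def)
          ultimately show ?thesis using less.hyps t(1) by blast
        qed
        obtain t where t: "t > 0" "x + t *\<^sub>R y \<in> convex hull V" using step[of y] y by blast
        have "\<phi> (- y) = 0" if "\<phi> \<in> A x" for \<phi>
          using y(2)[OF that] linear_neg[OF lin, of \<phi> y] that by (simp add: A_def)
        then obtain s where s: "s > 0" "x + s *\<^sub>R (- y) \<in> convex hull V"
          using step[of "- y"] y S by (auto simp: subspace_neg)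
        have "(s / (s + t)) *\<^sub>R (x + t *\<^sub>R y) + (t / (s + t)) *\<^sub>R (x + s *\<^sub>R (- y)) \<in> convex hull V"
          using s t by (intro convexD[OF convex_convex_hull]) (auto simp: add_divide_distrib[symmetric])
        moreover have "(s / (s + t)) *\<^sub>R (x + t *\<^sub>R y) + (t / (s + t)) *\<^sub>R (x + s *\<^sub>R (- y)) = x"
        proof -
          have "(s / (s + t)) *\<^sub>R (x + t *\<^sub>R y) + (t / (s + t)) *\<^sub>R (x + s *\<^sub>R (- y))
              = (s / (s + t) + t / (s + t)) *\<^sub>R x"
            by (simp add: algebra_simps)
          also have "s / (s + t) + t / (s + t) = 1"
            using s t by (simp add: add_divide_distrib[symmetric])
          finally show ?thesis by simp
        qed
        ultimately show ?thesis by simp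
      qed
    qed
    then show "P \<subseteq> convex hull V" by blast
  qed
  ultimately show ?thesis unfolding polytope_def P_def by blast
qed

lemma polytope_unit_ball_max_of_functionals:
  fixes N :: "'a::real_vector \<Rightarrow> real"
  assumes S: "subspace S" and mx: "max_of_functionals_on S N"
    and pos: "\<And>x. x \<in> S \<Longrightarrow> N x = 0 \<Longrightarrow> x = 0"
  shows "polytope (unit_ball N \<inter> S)"
proof -
  obtain \<Phi> where \<Phi>: "finite \<Phi>" "\<And>\<phi>. \<phi> \<in> \<Phi> \<Longrightarrow> linear \<phi>"
    "\<And>x \<phi>. x \<in> S \<Longrightarrow> \<phi> \<in> \<Phi> \<Longrightarrow> \<bar>\<phi> x\<bar> \<le> N x"
    "\<And>x. x \<in> S \<Longrightarrow> \<exists>\<phi>\<in>\<Phi>. N x = \<bar>\<phi> x\<bar>"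
    using mx unfolding max_of_functionals_on_def by blast
  have "x = 0" if "x \<in> S" "\<forall>\<phi>\<in>\<Phi>. \<phi> x = 0" for x
    using \<Phi>(4)[OF that(1)] that pos by force
  then have "polytope {x\<in>S. \<forall>\<phi>\<in>\<Phi>. \<bar>\<phi> x\<bar> \<le> 1}"
    using polytope_bounded_constraints[OF S \<Phi>(1,2)] by blast
  moreover have "{x\<in>S. \<forall>\<phi>\<in>\<Phi>. \<bar>\<phi> x\<bar> \<le> 1} = unit_ball N \<inter> S"
    using \<Phi>(3,4) by (fastforce simp: unit_ball_def)
  ultimately show ?thesis by simp
qed

section \<open>Supporting functionals\<close>

definition sublinear :: "('a::real_vector \<Rightarrow> real) \<Rightarrow> bool" where
  "sublinear p \<longleftrightarrow> (\<forall>x y. p (x + y) \<le> p x + p y) \<and> (\<forall>a x. 0 \<le> a \<longrightarrow> p (a *\<^sub>R x) = a * p x)"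

lemma sublinear_zero: "sublinear p \<Longrightarrow> p 0 = 0"
  unfolding sublinear_def by (metis mult_zero_left order_refl scale_zero_left)

lemma sublinear_neg_le: "sublinear p \<Longrightarrow> - p (- x) \<le> p x"
  using sublinear_zero[of p] unfolding sublinear_def
  by (metis add.right_inverse add_le_cancel_right add.left_inverse)

text \<open>
  Taking \<open>q x = inf\<^sub>t (p (x + t v) - t p(v))\<close> over \<open>t \<ge> 0\<close> makes the functional linear along the
  line through \<open>v\<close>: its value at \<open>- v\<close> is pushed down to the least one that sublinearity permits.
  This is the only way in which linearity is produced below.
\<close>

lemma sublinear_flatten:
  assumes p: "sublinear p"
  obtains q where "sublinear q" "\<And>x. q x \<le> p x" "q (- v) \<le> - p v"
proof -
  define q where "q x = (INF t\<in>{0..}. p (x + t *\<^sub>R v) - t * p v)" for x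
  have add: "p (x + y) \<le> p x + p y" for x y using p by (simp add: sublinear_def)
  have hom: "0 \<le> a \<Longrightarrow> p (a *\<^sub>R x) = a * p x" for a x using p by (simp add: sublinear_def)
  have low: "- p (- x) \<le> p (x + t *\<^sub>R v) - t * p v" if "t \<ge> 0" for x t
    using add[of "x + t *\<^sub>R v" "- x"] hom[OF that, of v] by simp
  have bdd: "bdd_below ((\<lambda>t. p (x + t *\<^sub>R v) - t * p v) ` {0..})" for x
    using low by (intro bdd_belowI2[where m="- p (- x)"]) auto
  have le: "q x \<le> p (x + t *\<^sub>R v) - t * p v" if "t \<ge> 0" for x t
    unfolding q_def using that by (intro cINF_lower[OF bdd]) auto
  have ge: "m \<le> q x" if "\<And>t. t \<ge> 0 \<Longrightarrow> m \<le> p (x + t *\<^sub>R v) - t * p v" for m x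
    unfolding q_def using that by (intro cINF_greatest) auto
  have qadd: "q (x + y) \<le> q x + q y" for x y
  proof -
    have "q (x + y) - (p (y + s *\<^sub>R v) - s * p v) \<le> q x" if s: "s \<ge> 0" for s
    proof (rule ge)
      fix t :: real assume t: "t \<ge> 0"
      have "q (x + y) \<le> p (x + y + (t + s) *\<^sub>R v) - (t + s) * p v" using le s t by simp
      also have "p (x + y + (t + s) *\<^sub>R v) \<le> p (x + t *\<^sub>R v) + p (y + s *\<^sub>R v)"
        using add[of "x + t *\<^sub>R v" "y + s *\<^sub>R v"] by (simp add: algebra_simps)
      finally show "q (x + y) - (p (y + s *\<^sub>R v) - s * p v) \<le> p (x + t *\<^sub>R v) - t * p v"
        by (simp add: algebra_simps)
    qed
    then have "q (x + y) - q x \<le> q y" by (intro ge) (simp add: algebra_simps)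
    then show ?thesis by simp
  qed
  have qscale: "a * q x \<le> q (a *\<^sub>R x)" if a: "a > 0" for a x
  proof (rule ge)
    fix t :: real assume t: "t \<ge> 0"
    have "q x \<le> p (x + (t / a) *\<^sub>R v) - (t / a) * p v"
      using a t by (intro le) simp
    then have "a * q x \<le> a * (p (x + (t / a) *\<^sub>R v) - (t / a) * p v)"
      using a by simp
    then have "a * q x \<le> a * p (x + (t / a) *\<^sub>R v) - t * p v"
      using a by (simp add: algebra_simps)
    also have "a * p (x + (t / a) *\<^sub>R v) = p (a *\<^sub>R x + t *\<^sub>R v)"
      using hom[of a "x + (t / a) *\<^sub>R v"] a by (simp add: scaleR_add_right)
    finally show "a * q x \<le> p (a *\<^sub>R x + t *\<^sub>R v) - t * p v" .
  qed
  have p0: "p 0 = 0" using sublinear_zero[OF p] .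
  have "q 0 = 0"
    using ge[of 0 0] le[of 0 0] hom[of _ v] p0 by force
  have qhom: "q (a *\<^sub>R x) = a * q x" if "a \<ge> 0" for a x
  proof (cases "a = 0")
    case True then show ?thesis using \<open>q 0 = 0\<close> by simp
  next
    case False
    then have a: "a > 0" using that by simp
    have "(1 / a) * q (a *\<^sub>R x) \<le> q x" using qscale[of "1 / a" "a *\<^sub>R x"] a by simp
    then have "q (a *\<^sub>R x) \<le> a * q x" using a by (simp add: field_simps)
    then show ?thesis using qscale[OF a, of x] by simp
  qed
  show ?thesis
  proof
    show "sublinear q" using qadd qhom by (simp add: sublinear_def)
    show "q x \<le> p x" for x using le[of 0 x] by simp
    show "q (- v) \<le> - p v" using le[of 1 "- v"] p0 by simp
  qed
qed

text \<open>
  Zorn's lemma for the reversed pointwise order. A chain has its pointwise infimum as a lower bound: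
  it is finite because \<open>q x \<ge> - p (- x)\<close> for all \<open>q \<le> p\<close>, and it is subadditive because two members of
  the chain can be replaced by the smaller of them.
\<close>

lemma minimal_sublinear_below:
  assumes p: "sublinear p"
  obtains q where "sublinear q" "\<And>x. q x \<le> p x"
    "\<And>r. sublinear r \<Longrightarrow> (\<And>x. r x \<le> q x) \<Longrightarrow> r = q"
proof -
  define A where "A = {q. sublinear q \<and> (\<forall>x. q x \<le> p x)}"
  define R where "R = (\<lambda>q r :: 'a \<Rightarrow> real. \<forall>x. r x \<le> q x)"
  have "\<exists>m\<in>A. \<forall>a\<in>A. R m a \<longrightarrow> a = m"
  proof (rule predicate_Zorn)
    show "partial_order_on A (relation_of R A)"
      unfolding R_def
      by (auto simp: partial_order_on_def preorder_on_def refl_on_def trans_def antisym_def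
          relation_of_def fun_eq_iff intro: order_trans order_antisym)
  next
    fix C assume "C \<in> Chains (relation_of R A)"
    then have CA: "C \<subseteq> A" and tot: "\<And>q r. q \<in> C \<Longrightarrow> r \<in> C \<Longrightarrow> R q r \<or> R r q"
      by (auto simp: Chains_def relation_of_def)
    show "\<exists>u\<in>A. \<forall>a\<in>C. R a u"
    proof (cases "C = {}")
      case True
      then show ?thesis using p by (auto simp: A_def)
    next
      case False
      define u where "u x = (INF q\<in>C. q x)" for x
      have low: "- p (- x) \<le> q x" if "q \<in> C" for q x
      proof -
        have "sublinear q" "q (- x) \<le> p (- x)" using CA that by (auto simp: A_def)
        then show ?thesis using sublinear_neg_le[of q x] by linarith
      qed
      have bdd: "bdd_below ((\<lambda>q. q x) ` C)" for x
        using low by (intro bdd_belowI2) auto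
      have le: "u x \<le> q x" if "q \<in> C" for q x
        unfolding u_def by (rule cINF_lower[OF bdd that])
      have ge: "m \<le> u x" if "\<And>q. q \<in> C \<Longrightarrow> m \<le> q x" for m x
        unfolding u_def by (rule cINF_greatest[OF False that])
      have "u (x + y) \<le> u x + u y" for x y
      proof -
        have "u (x + y) - r y \<le> u x" if r: "r \<in> C" for r
        proof (rule ge)
          fix q assume q: "q \<in> C"
          have "\<exists>s\<in>C. s x \<le> q x \<and> s y \<le> r y"
            using tot[OF q r] q r by (auto simp: R_def)
          then obtain s where s: "s \<in> C" "s x \<le> q x" "s y \<le> r y" by blast
          have "s (x + y) \<le> s x + s y" using s(1) CA by (auto simp: A_def sublinear_def)
          then show "u (x + y) - r y \<le> q x" using le[OF s(1), of "x + y"] s by simp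
        qed
        then have "u (x + y) - u x \<le> u y" by (intro ge) (simp add: algebra_simps)
        then show ?thesis by simp
      qed
      moreover have "u (a *\<^sub>R x) = a * u x" if a: "a \<ge> 0" for a x
      proof -
        have hom: "q (a *\<^sub>R x) = a * q x" if "q \<in> C" for q
          using that CA a by (auto simp: A_def sublinear_def)
        show ?thesis
        proof (cases "a = 0")
          case True
          have "q 0 = 0" if "q \<in> C" for q using hom[OF that] True by simp
          then have "u 0 = 0" using False le[of _ 0] ge[of 0 0] by force
          then show ?thesis using True by simp
        next
          case nz: False
          have "u (a *\<^sub>R x) / a \<le> u x"
          proof (rule ge)
            fix q assume q: "q \<in> C"
            show "u (a *\<^sub>R x) / a \<le> q x"
              using le[OF q, of "a *\<^sub>R x"] hom[OF q] a nz by (simp add: field_simps)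
          qed
          moreover have "a * u x \<le> u (a *\<^sub>R x)"
            using le a hom by (intro ge) (metis mult_left_mono)
          ultimately show ?thesis using a nz by (simp add: field_simps)
        qed
      qed
      moreover have "u x \<le> p x" for x
        using False le CA by (force simp: A_def intro: order_trans)
      ultimately have "u \<in> A" by (simp add: A_def sublinear_def)
      then show ?thesis using le by (auto simp: R_def)
    qed
  qed
  then obtain q where q: "q \<in> A" "\<And>a. a \<in> A \<Longrightarrow> R q a \<Longrightarrow> a = q" by blast
  show ?thesis
  proof
    show "sublinear q" "q x \<le> p x" for x using q(1) by (auto simp: A_def)
    fix r assume r: "sublinear r" "\<And>x. r x \<le> q x"
    then have "r \<in> A" using q(1) by (auto simp: A_def intro: order_trans)
    then show "r = q" using q(2) r(2) by (simp add: R_def)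
  qed
qed

text \<open>
  A minimal sublinear functional cannot be changed by flattening, hence it is odd in every
  direction, and an odd sublinear functional is linear.
\<close>

lemma linear_if_minimal_sublinear:
  assumes q: "sublinear q"
    and min: "\<And>r. sublinear r \<Longrightarrow> (\<And>x. r x \<le> q x) \<Longrightarrow> r = q"
  shows "linear q"
proof -
  have odd: "q (- x) = - q x" for x
  proof -
    obtain r where "sublinear r" "\<And>y. r y \<le> q y" "r (- x) \<le> - q x"
      using sublinear_flatten[OF q] by blast
    then show ?thesis using min[of r] sublinear_neg_le[OF q, of x] by force
  qed
  have sub: "q (x + y) \<le> q x + q y" for x y using q by (simp add: sublinear_def)
  have add: "q (x + y) = q x + q y" for x y
    using sub[of x y] sub[of "x + y" "- y"] odd[of y] by simp
  have scale: "q (a *\<^sub>R x) = a * q x" for a x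
  proof (cases "a \<ge> 0")
    case True then show ?thesis using q by (simp add: sublinear_def)
  next
    case False
    then have "0 \<le> - a" by simp
    then have "q ((- a) *\<^sub>R x) = (- a) * q x" using q unfolding sublinear_def by blast
    then show ?thesis using odd[of "a *\<^sub>R x"] by simp
  qed
  show ?thesis using add scale by (intro linearI) auto
qed

text \<open>
  The Hahn--Banach theorem in the form of a supporting functional: flattening along \<open>v\<close> first
  forces every functional below it to attain \<open>p\<close> at \<open>v\<close>.
\<close>

lemma Hahn_Banach_support:
  assumes p: "sublinear p"
  obtains f where "linear f" "\<And>x. f x \<le> p x" "f v = p v"
proof -
  obtain q where q: "sublinear q" "\<And>x. q x \<le> p x" "q (- v) \<le> - p v"
    using sublinear_flatten[OF p] by blast
  obtain f where f: "sublinear f" "\<And>x. f x \<le> q x"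
    "\<And>r. sublinear r \<Longrightarrow> (\<And>x. r x \<le> f x) \<Longrightarrow> r = f"
    using minimal_sublinear_below[OF q(1)] by blast
  have lin: "linear f" using linear_if_minimal_sublinear[OF f(1)] f(3) by blast
  have le: "f x \<le> p x" for x using f(2) q(2) order_trans by blast
  have "- f v \<le> - p v" using f(2)[of "- v"] q(3) linear_neg[OF lin, of v] by simp
  then show ?thesis using that lin le[of v] le by force
qed

section \<open>Finite-dimensional subspaces\<close>

lemma closed_if_compact_cball_Int:
  fixes S :: "'a::real_normed_vector set"
  assumes "\<And>r. compact (cball 0 r \<inter> S)"
  shows "closed S"
  unfolding closed_sequential_limits
proof (intro allI impI)
  fix x :: "nat \<Rightarrow> 'a" and l assume h: "(\<forall>n. x n \<in> S) \<and> x \<longlonglongrightarrow> l"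
  then obtain r where "\<And>n. norm (x n) \<le> r"
    using convergent_imp_Bseq[of x] by (auto simp: convergent_def Bseq_def)
  then have "\<And>n. x n \<in> cball 0 r \<inter> S" using h by simp
  then have "l \<in> cball 0 r \<inter> S"
    using h closed_sequentially[OF compact_imp_closed[OF assms]] by blast
  then show "l \<in> S" by simp
qed

text \<open>
  Induction on the generators. When \<open>v\<close> is new, it has positive distance \<open>d\<close> from the closed span of
  the others, so the coefficient of \<open>v\<close> in a vector \<open>x\<close> is at most \<open>norm x / d\<close>. Hence the ball
  is cut out of the image of a compact product set under \<open>(e, k) \<mapsto> e + k v\<close>.
\<close>

lemma compact_cball_Int_span:
  fixes F :: "'a::real_normed_vector set"
  assumes "finite F"
  shows "compact (cball 0 r \<inter> span F)"
  using assms
proof (induction F arbitrary: r rule: finite_induct)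
  case empty
  have "cball 0 r \<inter> span {} = (if r \<ge> 0 then {0} else {} :: 'a set)" by auto
  then show ?case by simp
next
  case (insert v F)
  show ?case
  proof (cases "v \<in> span F")
    case True
    then show ?thesis using insert.IH by (simp add: span_redundant)
  next
    case False
    have cl: "closed (span F)" using insert.IH by (rule closed_if_compact_cball_Int)
    define d where "d = infdist v (span F)"
    have d: "d > 0" unfolding d_def using cl False span_zero
      by (intro infdist_pos_not_in_closed) auto
    have coef: "\<bar>k\<bar> * d \<le> norm x" if x: "x - k *\<^sub>R v \<in> span F" for x k
    proof (cases "k = 0")
      case nz: False
      have "v - (1 / k) *\<^sub>R x = (- 1 / k) *\<^sub>R (x - k *\<^sub>R v)" using nz by (simp add: algebra_simps)
      then have "v - (1 / k) *\<^sub>R x \<in> span F" using x span_scale by metis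
      then have "d \<le> norm ((1 / k) *\<^sub>R x)"
        unfolding d_def using infdist_le[of "v - (1 / k) *\<^sub>R x" "span F" v] by (simp add: dist_norm)
      then show ?thesis using nz by (simp add: field_simps)
    qed simp
    define R where "R = r + (r / d) * norm v"
    define g where "g = (\<lambda>(e, k). e + k *\<^sub>R v)"
    have "cball 0 r \<inter> span (insert v F)
        = cball 0 r \<inter> g ` ((cball 0 R \<inter> span F) \<times> {- (r / d)..r / d})" (is "?A = ?B")
    proof
      show "?A \<subseteq> ?B"
      proof
        fix x assume x: "x \<in> ?A"
        then obtain k where k: "x - k *\<^sub>R v \<in> span F" by (auto simp: span_breakdown_eq)
        have "\<bar>k\<bar> * d \<le> r" using coef[OF k] x by simp
        then have kb: "\<bar>k\<bar> \<le> r / d" using d by (simp add: field_simps)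
        have "norm (x - k *\<^sub>R v) \<le> norm x + \<bar>k\<bar> * norm v"
          using norm_triangle_ineq4[of x "k *\<^sub>R v"] by simp
        also have "\<dots> \<le> R" unfolding R_def
          using x kb by (intro add_mono mult_right_mono) auto
        finally have "(x - k *\<^sub>R v, k) \<in> (cball 0 R \<inter> span F) \<times> {- (r / d)..r / d}"
          using k kb by (auto simp: abs_le_iff)
        moreover have "x = g (x - k *\<^sub>R v, k)" by (simp add: g_def)
        ultimately show "x \<in> ?B" using x by blast
      qed
      show "?B \<subseteq> ?A"
      proof
        fix x assume "x \<in> ?B"
        then obtain e k where "x \<in> cball 0 r" "e \<in> span F" "x = e + k *\<^sub>R v"
          by (auto simp: g_def)
        moreover from this have "x - k *\<^sub>R v \<in> span F" by simp
        ultimately have "x \<in> cball 0 r" "\<exists>k. x - k *\<^sub>R v \<in> span F" by blast+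
        then show "x \<in> ?A" by (simp add: span_breakdown_eq)
      qed
    qed
    moreover have "compact (g ` ((cball 0 R \<inter> span F) \<times> {- (r / d)..r / d}))"
      unfolding g_def case_prod_unfold
      by (intro compact_continuous_image continuous_intros compact_Times insert.IH) simp
    ultimately show ?thesis by (simp add: closed_Int_compact)
  qed
qed

lemma closed_span_finite:
  fixes F :: "'a::real_normed_vector set"
  assumes "finite F"
  shows "closed (span F)"
  by (rule closed_if_compact_cball_Int) (rule compact_cball_Int_span[OF assms])

lemma sublinear_infdist:
  fixes S :: "'a::real_normed_vector set"
  assumes S: "subspace S"
  shows "sublinear (\<lambda>x. infdist x S)"
proof -
  have ne: "S \<noteq> {}" using S subspace_0 by blast
  have ge: "m \<le> infdist x S" if "\<And>a. a \<in> S \<Longrightarrow> m \<le> norm (x - a)" for m x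
    unfolding infdist_notempty[OF ne] dist_norm using that by (intro cINF_greatest[OF ne])
  have le: "infdist x S \<le> norm (x - a)" if "a \<in> S" for x a
    using infdist_le[OF that] by (simp add: dist_norm)
  have add: "infdist (x + y) S \<le> infdist x S + infdist y S" for x y
  proof -
    have "infdist (x + y) S - norm (y - b) \<le> infdist x S" if b: "b \<in> S" for b
    proof (rule ge)
      fix a assume a: "a \<in> S"
      have "infdist (x + y) S \<le> norm (x + y - (a + b))" using le a b S subspace_add by blast
      also have "\<dots> \<le> norm (x - a) + norm (y - b)"
        using norm_triangle_ineq[of "x - a" "y - b"] by (simp add: algebra_simps)
      finally show "infdist (x + y) S - norm (y - b) \<le> norm (x - a)" by simp
    qed
    then have "infdist (x + y) S - infdist x S \<le> infdist y S" by (intro ge) (simp add: algebra_simps)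
    then show ?thesis by simp
  qed
  have half: "infdist (k *\<^sub>R x) S \<le> k * infdist x S" if k: "k > 0" for k x
  proof -
    have "infdist (k *\<^sub>R x) S / k \<le> infdist x S"
    proof (rule ge)
      fix a assume a: "a \<in> S"
      have "infdist (k *\<^sub>R x) S \<le> norm (k *\<^sub>R x - k *\<^sub>R a)" using le a S subspace_scale by blast
      also have "\<dots> = k * norm (x - a)" using k by (simp add: scaleR_diff_right[symmetric])
      finally show "infdist (k *\<^sub>R x) S / k \<le> norm (x - a)" using k by (simp add: field_simps)
    qed
    then show ?thesis using k by (simp add: field_simps)
  qed
  have "infdist (k *\<^sub>R x) S = k * infdist x S" if "k \<ge> 0" for k x
  proof (cases "k = 0")
    case True
    then show ?thesis using subspace_0[OF S] by simp
  next
    case False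
    then have k: "k > 0" using that by simp
    show ?thesis using half[OF k, of x] half[of "1 / k" "k *\<^sub>R x"] k by (simp add: field_simps)
  qed
  then show ?thesis using add by (simp add: sublinear_def)
qed

text \<open>
  The distance to \<open>S\<close> is sublinear, vanishes on \<open>S\<close> and is positive at \<open>v\<close>; a functional that supports
  it at \<open>v\<close> does what is needed.
\<close>

lemma separate_from_closed_subspace:
  fixes S :: "'a::real_normed_vector set"
  assumes S: "subspace S" "closed S" and v: "v \<notin> S"
  obtains h where "linear h" "\<And>x. \<bar>h x\<bar> \<le> norm x" "\<And>x. x \<in> S \<Longrightarrow> h x = 0" "h v > 0"
proof -
  obtain h where h: "linear h" "\<And>x. h x \<le> infdist x S" "h v = infdist v S"
    using Hahn_Banach_support[OF sublinear_infdist[OF S(1)]] by blast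
  have neg: "h (- x) = - h x" for x using linear_neg[OF h(1)] .
  have le: "infdist x S \<le> norm x" for x
    using infdist_le[OF subspace_0[OF S(1)], of x] by simp
  have "\<bar>h x\<bar> \<le> norm x" for x
    using h(2)[of x] h(2)[of "- x"] le[of x] le[of "- x"] neg[of x] by simp
  moreover have "h x = 0" if "x \<in> S" for x
    using h(2)[of x] h(2)[of "- x"] that subspace_neg[OF S(1) that] neg[of x] by simp
  moreover have "h v > 0"
    using h(3) infdist_pos_not_in_closed[OF S(2) _ v] subspace_0[OF S(1)] by auto
  ultimately show ?thesis using that h(1) by blast
qed

text \<open>
  Take functionals of norm at most one supporting the norm at the points of a fine net of the unit ball of
  \<open>span F\<close>. For \<open>x\<close> of norm one and \<open>a\<close> in the net near \<open>x\<close>, both \<open>norm a\<close> and the value of the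
  functional change little between \<open>a\<close> and \<open>x\<close>.
\<close>

lemma almost_norming_functionals:
  fixes F :: "'a::real_normed_vector set"
  assumes F: "finite F" and \<theta>: "\<theta> < 1"
  obtains \<Phi> where "finite \<Phi>" "\<And>\<phi>. \<phi> \<in> \<Phi> \<Longrightarrow> linear \<phi>"
    "\<And>\<phi> x. \<phi> \<in> \<Phi> \<Longrightarrow> \<bar>\<phi> x\<bar> \<le> norm x"
    "\<And>x. x \<in> span F \<Longrightarrow> \<exists>\<phi>\<in>\<Phi>. \<theta> * norm x \<le> \<bar>\<phi> x\<bar>"
proof -
  have sub: "sublinear (norm :: 'a \<Rightarrow> real)"
    by (simp add: sublinear_def norm_triangle_ineq)
  have "\<exists>f. linear f \<and> (\<forall>x. f x \<le> norm x) \<and> f a = norm a" for a :: 'a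
    using Hahn_Banach_support[OF sub] by metis
  then obtain f where f: "\<And>a. linear (f a)" "\<And>a x. f a x \<le> norm x"
    "\<And>a :: 'a. f a a = norm a" by metis
  have fabs: "\<bar>f a x\<bar> \<le> norm x" for a x
    using f(2)[of a x] f(2)[of a "- x"] linear_neg[OF f(1)[of a], of x] by simp
  have "compact (cball 0 1 \<inter> span F)" using F by (rule compact_cball_Int_span)
  then obtain K where K: "finite K" "cball 0 1 \<inter> span F \<subseteq> (\<Union>a\<in>K. ball a ((1 - \<theta>) / 2))"
    using seq_compact_imp_totally_bounded[of "cball 0 1 \<inter> span F"] \<theta>
    unfolding compact_eq_seq_compact_metric by (meson diff_gt_0_iff_gt half_gt_zero)
  show ?thesis
  proof
    show "finite (f ` K)" using K by simp
    show "linear \<phi>" if "\<phi> \<in> f ` K" for \<phi> using that f(1) by blast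
    show "\<bar>\<phi> x\<bar> \<le> norm x" if "\<phi> \<in> f ` K" for \<phi> x using that fabs by blast
    show "\<exists>\<phi>\<in>f ` K. \<theta> * norm x \<le> \<bar>\<phi> x\<bar>" if x: "x \<in> span F" for x
    proof -
      define y where "y = (1 / norm x) *\<^sub>R x"
      have y: "y \<in> cball 0 1 \<inter> span F" unfolding y_def using x span_scale by auto
      then obtain a where a: "a \<in> K" "dist a y < (1 - \<theta>) / 2" using K(2) by fastforce
      have "\<theta> * norm x \<le> \<bar>f a x\<bar>"
      proof (cases "x = 0")
        case False
        have "norm y = 1" using False by (simp add: y_def)
        then have "norm a \<ge> 1 - dist a y"
          using norm_triangle_ineq2[of y a] by (simp add: dist_norm norm_minus_commute)
        moreover have "f a a - f a y \<le> dist a y"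
          using f(2)[of a "a - y"] linear_diff[OF f(1)[of a], of a y] by (simp add: dist_norm)
        ultimately have "\<theta> \<le> f a y" using a(2) f(3)[of a] by simp
        moreover have "f a y = f a x / norm x"
          using linear_cmul[OF f(1)[of a], of "1 / norm x" x] by (simp add: y_def)
        ultimately show ?thesis using False by (simp add: field_simps abs_le_iff)
      qed simp
      then show ?thesis using a(1) by blast
    qed
  qed
qed

section \<open>Polyhedral norms as local maxima of functionals\<close>

lemma max_of_functionals_on_triangle:
  assumes "max_of_functionals_on S N" "x \<in> S" "y \<in> S" "x + y \<in> S"
  shows "N (x + y) \<le> N x + N y"
proof -
  obtain \<Phi> where \<Phi>: "\<And>\<phi>. \<phi> \<in> \<Phi> \<Longrightarrow> linear \<phi>"
    "\<And>x \<phi>. x \<in> S \<Longrightarrow> \<phi> \<in> \<Phi> \<Longrightarrow> \<bar>\<phi> x\<bar> \<le> N x"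
    "\<And>x. x \<in> S \<Longrightarrow> \<exists>\<phi>\<in>\<Phi>. N x = \<bar>\<phi> x\<bar>"
    using assms(1) unfolding max_of_functionals_on_def by blast
  obtain \<phi> where \<phi>: "\<phi> \<in> \<Phi>" "N (x + y) = \<bar>\<phi> (x + y)\<bar>" using \<Phi>(3) assms(4) by blast
  then show ?thesis
    using \<Phi>(2)[OF assms(2) \<phi>(1)] \<Phi>(2)[OF assms(3) \<phi>(1)] linear_add[OF \<Phi>(1)[OF \<phi>(1)], of x y]
    by simp
qed

lemma max_of_functionals_on_scale:
  assumes "max_of_functionals_on S N" "x \<in> S" "a *\<^sub>R x \<in> S"
  shows "N (a *\<^sub>R x) = \<bar>a\<bar> * N x"
proof -
  obtain \<Phi> where \<Phi>: "\<And>\<phi>. \<phi> \<in> \<Phi> \<Longrightarrow> linear \<phi>"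
    "\<And>x \<phi>. x \<in> S \<Longrightarrow> \<phi> \<in> \<Phi> \<Longrightarrow> \<bar>\<phi> x\<bar> \<le> N x"
    "\<And>x. x \<in> S \<Longrightarrow> \<exists>\<phi>\<in>\<Phi>. N x = \<bar>\<phi> x\<bar>"
    using assms(1) unfolding max_of_functionals_on_def by blast
  have lin: "\<bar>\<phi> (a *\<^sub>R x)\<bar> = \<bar>a\<bar> * \<bar>\<phi> x\<bar>" if "\<phi> \<in> \<Phi>" for \<phi>
    using linear_cmul[OF \<Phi>(1)[OF that]] by (simp add: abs_mult)
  obtain \<phi> where \<phi>: "\<phi> \<in> \<Phi>" "N (a *\<^sub>R x) = \<bar>\<phi> (a *\<^sub>R x)\<bar>" using \<Phi>(3) assms(3) by blast
  obtain \<psi> where \<psi>: "\<psi> \<in> \<Phi>" "N x = \<bar>\<psi> x\<bar>" using \<Phi>(3) assms(2) by blast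
  have "N (a *\<^sub>R x) \<le> \<bar>a\<bar> * N x"
    using \<phi> lin[OF \<phi>(1)] \<Phi>(2)[OF assms(2) \<phi>(1)] by (simp add: mult_left_mono)
  moreover have "\<bar>a\<bar> * N x \<le> N (a *\<^sub>R x)"
    using \<psi> lin[OF \<psi>(1)] \<Phi>(2)[OF assms(3) \<psi>(1)] by simp
  ultimately show ?thesis by simp
qed

lemma max_of_functionals_on_mono:
  "max_of_functionals_on S N \<Longrightarrow> T \<subseteq> S \<Longrightarrow> max_of_functionals_on T N"
  unfolding max_of_functionals_on_def by (meson subsetD)

lemma max_of_functionals_on_cong:
  "max_of_functionals_on S N \<Longrightarrow> (\<And>x. x \<in> S \<Longrightarrow> N x = M x) \<Longrightarrow> max_of_functionals_on S M"
  unfolding max_of_functionals_on_def by simp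

definition locally_max_of_functionals :: "('a::real_vector \<Rightarrow> real) \<Rightarrow> bool" where
  "locally_max_of_functionals N \<longleftrightarrow> (\<forall>F. finite F \<longrightarrow> max_of_functionals_on (span F) N)"

lemma is_norm_if_locally_max_of_functionals:
  fixes N :: "'a::real_normed_vector \<Rightarrow> real"
  assumes mx: "locally_max_of_functionals N" and low: "\<And>x. norm x \<le> N x"
  shows "is_norm N"
proof -
  have on: "max_of_functionals_on (span {x, y}) N" for x y
    using mx by (simp add: locally_max_of_functionals_def)
  have tri: "N (x + y) \<le> N x + N y" for x y
    by (rule max_of_functionals_on_triangle[OF on[of x y]]) (auto intro: span_base span_add)
  have sc: "N (a *\<^sub>R x) = \<bar>a\<bar> * N x" for a x
    by (rule max_of_functionals_on_scale[OF on[of x x]]) (auto intro: span_base span_scale)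
  have "N 0 = 0" using sc[of 0 0] by simp
  moreover have "x = 0" if "N x = 0" for x using low[of x] that by simp
  moreover have "0 \<le> N x" for x using low[of x] norm_ge_zero[of x] by linarith
  ultimately show ?thesis using tri sc unfolding is_norm_def by blast
qed

lemma polyhedral_norm_if_locally_max_of_functionals:
  fixes N :: "'a::real_normed_vector \<Rightarrow> real"
  assumes mx: "locally_max_of_functionals N" and low: "\<And>x. norm x \<le> N x"
  shows "polyhedral_norm N"
  unfolding polyhedral_norm_def
proof (intro allI impI)
  fix F :: "'a set" assume "finite F"
  then have "max_of_functionals_on (span F) N"
    using mx by (simp add: locally_max_of_functionals_def)
  moreover have "x = 0" if "N x = 0" for x using low[of x] that by simp
  ultimately show "polytope (unit_ball N \<inter> span F)"
    by (intro polytope_unit_ball_max_of_functionals) auto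
qed

text \<open>
  Both limits taken below, of the partial maxima that form the first polyhedral norm and of the successive
  renormings, are of this kind: on each member of an exhaustion the sequence is eventually
  constant. So the limit inherits every property that concerns finitely many vectors at a time.
\<close>

lemma glue_along_exhaustion:
  fixes W :: "nat \<Rightarrow> 'a set" and G :: "nat \<Rightarrow> 'a \<Rightarrow> real"
  assumes mono: "mono W" and cover: "\<And>x. \<exists>n. x \<in> W n"
    and stable: "\<And>n x. x \<in> W n \<Longrightarrow> G (Suc n) x = G n x"
  obtains N where "\<And>m n x. x \<in> W n \<Longrightarrow> n \<le> m \<Longrightarrow> G m x = N x"
proof -
  have const: "G m x = G n x" if "x \<in> W n" "n \<le> m" for m n x
    using that(2)
  proof (induction m rule: dec_induct)
    case (step k)
    then have "x \<in> W k" using that(1) monoD[OF mono, of n k] by auto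
    then show ?case using step stable by simp
  qed simp
  define l where "l x = (LEAST n. x \<in> W n)" for x
  have l: "x \<in> W (l x)" for x unfolding l_def using cover by (rule LeastI_ex)
  have le: "l x \<le> n" if "x \<in> W n" for x n unfolding l_def using that by (rule Least_le)
  show ?thesis
  proof (rule that[of "\<lambda>x. G (l x) x"])
    fix m n x assume "x \<in> W n" "n \<le> m"
    then show "G m x = G (l x) x" using const[OF l, of x m] le[of x n] by simp
  qed
qed

lemma locally_max_of_functionals_glue:
  fixes W :: "nat \<Rightarrow> 'a::real_vector set"
  assumes mono: "mono W" and sub: "\<And>n. subspace (W n)" and cover: "\<And>x. \<exists>n. x \<in> W n"
    and mx: "\<And>n. max_of_functionals_on (W n) N"
  shows "locally_max_of_functionals N"
  unfolding locally_max_of_functionals_def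
proof (intro allI impI)
  fix F :: "'a set" assume "finite F"
  then have "\<exists>n. F \<subseteq> W n"
  proof (induction F rule: finite_induct)
    case (insert x F)
    then obtain m n where "F \<subseteq> W m" "x \<in> W n" using cover by blast
    then have "insert x F \<subseteq> W (max m n)"
      using monoD[OF mono, of m "max m n"] monoD[OF mono, of n "max m n"] by auto
    then show ?case by blast
  qed simp
  then obtain n where "F \<subseteq> W n" by blast
  then have "span F \<subseteq> W n" using sub by (simp add: span_minimal)
  then show "max_of_functionals_on (span F) N"
    using max_of_functionals_on_mono mx by blast
qed

text \<open>
  Let \<open>a n\<close> decrease strictly to 1, and let \<open>\<Phi> n\<close> be functionals of norm at most one that norm
  \<open>span (E n)\<close> up to the factor \<open>a (n + 1) / a n\<close>. The wanted norm is the supremum of all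
  \<open>a n * \<bar>\<phi>\<bar>\<close> with \<open>\<phi>\<close> in \<open>\<Phi> n\<close>. On \<open>span (E n)\<close> the \<open>n\<close>-th family already gives
  at least \<open>a (n + 1) * norm x\<close>, and the later families never exceed this, so only finitely many
  functionals count there.
\<close>

lemma polyhedral_base_norm:
  fixes E :: "nat \<Rightarrow> 'a::real_normed_vector set"
  assumes mono: "mono (\<lambda>n. span (E n))" and fin: "\<And>n. finite (E n)"
    and cover: "\<And>x. \<exists>n. x \<in> span (E n)"
  obtains N :: "'a \<Rightarrow> real" where "locally_max_of_functionals N"
    "\<And>x. norm x \<le> N x" "\<And>x. N x \<le> 2 * norm x"
proof -
  define a :: "nat \<Rightarrow> real" where "a n = 1 + 1 / (real n + 1)" for n
  have a: "1 \<le> a n" "a n \<le> 2" "a (Suc n) < a n" for n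
    by (auto simp: a_def field_simps)
  have "\<exists>\<Phi>. finite \<Phi> \<and> (\<forall>\<phi>\<in>\<Phi>. linear \<phi> \<and> (\<forall>x. \<bar>\<phi> x\<bar> \<le> norm x))
      \<and> (\<forall>x\<in>span (E n). \<exists>\<phi>\<in>\<Phi>. (a (Suc n) / a n) * norm x \<le> \<bar>\<phi> x\<bar>)" for n
  proof -
    have "a (Suc n) / a n < 1" using a(1,3)[of n] by simp
    from almost_norming_functionals[OF fin this, of n] show ?thesis by metis
  qed
  then obtain \<Phi> where \<Phi>: "\<And>n. finite (\<Phi> n)" "\<And>n \<phi>. \<phi> \<in> \<Phi> n \<Longrightarrow> linear \<phi>"
    "\<And>n \<phi> x. \<phi> \<in> \<Phi> n \<Longrightarrow> \<bar>\<phi> x\<bar> \<le> norm x"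
    "\<And>n x. x \<in> span (E n) \<Longrightarrow> \<exists>\<phi>\<in>\<Phi> n. (a (Suc n) / a n) * norm x \<le> \<bar>\<phi> x\<bar>"
    by metis
  define \<Psi> where "\<Psi> n = (\<lambda>\<phi> x. a n * \<phi> x) ` \<Phi> n" for n
  have \<Psi>fin: "finite (\<Psi> n)" for n using \<Phi>(1) by (simp add: \<Psi>_def)
  have \<Psi>lin: "linear \<psi>" if "\<psi> \<in> \<Psi> n" for \<psi> n
  proof -
    obtain \<phi> where \<phi>: "linear \<phi>" "\<psi> = (\<lambda>x. a n * \<phi> x)"
      using \<open>\<psi> \<in> \<Psi> n\<close> \<Phi>(2) by (auto simp: \<Psi>_def)
    then show ?thesis
      by (intro linearI) (simp_all add: linear_add linear_cmul distrib_left)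
  qed
  have \<Psi>le: "\<bar>\<psi> x\<bar> \<le> a n * norm x" if "\<psi> \<in> \<Psi> n" for \<psi> n x
    using that \<Phi>(3) a(1)[of n] by (auto simp: \<Psi>_def abs_mult intro!: mult_mono)
  have \<Psi>ge: "\<exists>\<psi>\<in>\<Psi> n. a (Suc n) * norm x \<le> \<bar>\<psi> x\<bar>" if x: "x \<in> span (E n)" for n x
  proof -
    obtain \<phi> where \<phi>: "\<phi> \<in> \<Phi> n" "(a (Suc n) / a n) * norm x \<le> \<bar>\<phi> x\<bar>" using \<Phi>(4)[OF x] by blast
    have "a (Suc n) * norm x \<le> a n * \<bar>\<phi> x\<bar>" using \<phi>(2) a(1)[of n] by (simp add: field_simps)
    then show ?thesis using \<phi>(1) a(1)[of n] by (auto simp: \<Psi>_def abs_mult)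
  qed
  define G where "G n x = Max ((\<lambda>\<psi>. \<bar>\<psi> x\<bar>) ` (\<Union>k\<le>n. \<Psi> k))" for n x
  have ne: "(\<Union>k\<le>n. \<Psi> k) \<noteq> {}" for n
    using \<Psi>ge[of 0 n] span_zero by blast
  have Gge: "\<bar>\<psi> x\<bar> \<le> G n x" if "\<psi> \<in> \<Psi> k" "k \<le> n" for \<psi> k n x
    unfolding G_def using that \<Psi>fin by (intro Max_ge) auto
  have Gin: "\<exists>k\<le>n. \<exists>\<psi>\<in>\<Psi> k. G n x = \<bar>\<psi> x\<bar>" for n x
  proof -
    have "G n x \<in> (\<lambda>\<psi>. \<bar>\<psi> x\<bar>) ` (\<Union>k\<le>n. \<Psi> k)"
      unfolding G_def using ne \<Psi>fin by (intro Max_in) auto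
    then show ?thesis by blast
  qed
  have big: "a (Suc n) * norm x \<le> G n x" if "x \<in> span (E n)" for n x
    using \<Psi>ge[OF that] Gge[of _ n n x] by force
  have Gmax: "max_of_functionals_on (span (E n)) (G n)" for n
    unfolding max_of_functionals_on_def
  proof (intro exI conjI ballI)
    show "finite (\<Union>k\<le>n. \<Psi> k)" using \<Psi>fin by simp
  next
    fix \<psi> assume "\<psi> \<in> (\<Union>k\<le>n. \<Psi> k)"
    then obtain k where k: "k \<le> n" "\<psi> \<in> \<Psi> k" by blast
    show "linear \<psi>" using \<Psi>lin[OF k(2)] .
    show "\<bar>\<psi> x\<bar> \<le> G n x" for x using Gge[OF k(2,1)] .
  next
    fix x
    show "\<exists>\<psi>\<in>\<Union>k\<le>n. \<Psi> k. G n x = \<bar>\<psi> x\<bar>" using Gin[of n x] by blast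
  qed
  have stable: "G (Suc n) x = G n x" if x: "x \<in> span (E n)" for n x
  proof (rule antisym)
    obtain k \<psi> where k: "k \<le> Suc n" "\<psi> \<in> \<Psi> k" "G (Suc n) x = \<bar>\<psi> x\<bar>" using Gin by blast
    show "G (Suc n) x \<le> G n x"
      using k Gge[of \<psi> k n x] \<Psi>le[of \<psi> k x] big[OF x] by (cases "k = Suc n") auto
    show "G n x \<le> G (Suc n) x" using Gin[of n x] Gge[of _ _ "Suc n" x] by force
  qed
  obtain N where N: "\<And>m n x. x \<in> span (E n) \<Longrightarrow> n \<le> m \<Longrightarrow> G m x = N x"
    using glue_along_exhaustion[OF mono cover, of G] stable by blast
  show ?thesis
  proof
    have "max_of_functionals_on (span (E n)) N" for n
      using max_of_functionals_on_cong[OF Gmax] N by blast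
    then show "locally_max_of_functionals N"
      using locally_max_of_functionals_glue[OF mono _ cover] by simp
    fix x
    obtain n where n: "x \<in> span (E n)" using cover by blast
    have Nx: "N x = G n x" using N[OF n] by simp
    have "1 * norm x \<le> a (Suc n) * norm x" using a(1) by (intro mult_right_mono) auto
    then show "norm x \<le> N x" using big[OF n] Nx by simp
    obtain k \<psi> where "\<psi> \<in> \<Psi> k" "G n x = \<bar>\<psi> x\<bar>" using Gin by blast
    moreover have "a k * norm x \<le> 2 * norm x" using a(2) by (intro mult_right_mono) auto
    ultimately show "N x \<le> 2 * norm x" using \<Psi>le[of \<psi> k x] Nx by simp
  qed
qed

section \<open>Making a point strongly exposed\<close>

lemma is_normD:
  assumes "is_norm N"
  shows "0 \<le> N x" "N x = 0 \<longleftrightarrow> x = 0" "N (x + y) \<le> N x + N y" "N (a *\<^sub>R x) = \<bar>a\<bar> * N x"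
  using assms by (auto simp: is_norm_def)

lemma is_norm_minus: "is_norm N \<Longrightarrow> N (- x) = N x"
  using is_normD(4)[of N "-1" x] by simp

lemma is_norm_diff: "is_norm N \<Longrightarrow> N (x - y) \<le> N x + N y"
  using is_normD(3)[of N x "- y"] is_norm_minus[of N y] by simp

text \<open>
  Controls the radial projection to the unit sphere, so that approximation of arbitrary vectors can
  be turned into approximation on the sphere.
\<close>

lemma is_norm_normalise_lipschitz:
  assumes N: "is_norm N" and a: "a \<noteq> 0" and b: "b \<noteq> 0"
  shows "N ((1 / N b) *\<^sub>R b - (1 / N a) *\<^sub>R a) \<le> 2 * N (b - a) / N a"
proof -
  have pos: "N a > 0" "N b > 0"
    using is_normD(1,2)[OF N] a b by (metis less_eq_real_def)+
  have rev: "\<bar>N a - N b\<bar> \<le> N (b - a)"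
    using is_normD(3)[OF N, of "b - a" a] is_normD(3)[OF N, of "a - b" b]
      is_norm_minus[OF N, of "b - a"] by simp
  have "(1 / N b) *\<^sub>R b - (1 / N a) *\<^sub>R a
      = (1 / N a) *\<^sub>R (b - a) + (1 / N b - 1 / N a) *\<^sub>R b"
    by (simp add: algebra_simps)
  then have "N ((1 / N b) *\<^sub>R b - (1 / N a) *\<^sub>R a)
      \<le> \<bar>1 / N a\<bar> * N (b - a) + \<bar>1 / N b - 1 / N a\<bar> * N b"
    using is_normD(3)[OF N, of "(1 / N a) *\<^sub>R (b - a)" "(1 / N b - 1 / N a) *\<^sub>R b"]
    by (simp add: is_normD(4)[OF N])
  also have "\<bar>1 / N b - 1 / N a\<bar> * N b = \<bar>N a - N b\<bar> / N a"
  proof -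
    have "1 / N b - 1 / N a = (N a - N b) / (N a * N b)" using pos by (simp add: field_simps)
    then show ?thesis using pos by (simp add: abs_mult)
  qed
  also have "\<bar>1 / N a\<bar> * N (b - a) + \<bar>N a - N b\<bar> / N a \<le> 2 * N (b - a) / N a"
    using rev pos by (simp add: field_simps)
  finally show ?thesis .
qed

text \<open>
  The function \<open>p x = \<bar>f x\<bar> + c * M (x - f x *\<^sub>R v)\<close> is a norm whose unit ball is a double cone with
  apices \<open>v\<close> and \<open>- v\<close>. The ball of \<open>M\<close> will be intersected with this cone, and the lemma says that
  this can be done without touching the ball on \<open>S\<close> and with as little loss as desired elsewhere.
  The functional is a small tilt, away from \<open>S\<close>, of a functional \<open>g\<close> supporting the ball at
  \<open>v\<close>: with \<open>h\<close> vanishing on \<open>S\<close>, the combination \<open>(1 - b) g + (b / h v) h\<close> keeps the value 1 at \<open>v\<close>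
  but is at most \<open>1 - b\<close> on the ball of \<open>S\<close>. The gap \<open>b\<close> leaves room for a small multiple of the
  second summand of \<open>p\<close>.
\<close>

lemma exposing_functional:
  fixes M :: "'a::real_normed_vector \<Rightarrow> real"
  assumes M: "is_norm M" and low: "\<And>x. norm x \<le> M x"
    and S: "subspace S" "closed S" and v: "v \<notin> S" "M v = 1" and r: "1 < r"
  obtains f c where "linear f" "0 < c" "f v = 1"
    "\<And>x. x \<in> S \<Longrightarrow> \<bar>f x\<bar> + c * M (x - f x *\<^sub>R v) \<le> M x"
    "\<And>x. \<bar>f x\<bar> + c * M (x - f x *\<^sub>R v) \<le> r * M x"
proof -
  note Mn = is_normD[OF M]
  have "sublinear M" using Mn by (simp add: sublinear_def)
  then obtain g where g: "linear g" "\<And>x. g x \<le> M x" "g v = 1"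
    using Hahn_Banach_support[of M v] v(2) by metis
  have gabs: "\<bar>g x\<bar> \<le> M x" for x
    using g(2)[of x] g(2)[of "- x"] linear_neg[OF g(1), of x] is_norm_minus[OF M, of x] by simp
  obtain h where h: "linear h" "\<And>x. \<bar>h x\<bar> \<le> norm x" "\<And>x. x \<in> S \<Longrightarrow> h x = 0" "h v > 0"
    using separate_from_closed_subspace[OF S v(1)] by blast
  define \<tau> where "\<tau> = h v"
  have \<tau>: "\<tau> > 0" using h(4) by (simp add: \<tau>_def)
  \<comment> \<open>\<open>b / \<tau> \<le> r - 1\<close> is what keeps \<open>p\<close> below \<open>r * M\<close> on the whole space\<close>
  define b where "b = min (1 / 2) (\<tau> * (r - 1))"
  have b: "0 < b" "b \<le> 1 / 2" "b \<le> \<tau> * (r - 1)" using \<tau> r by (auto simp: b_def)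
  then have b\<tau>: "b / \<tau> \<le> r - 1" "0 < b / \<tau>" using \<tau> by (auto simp: field_simps)
  define f where "f x = (1 - b) * g x + (b / \<tau>) * h x" for x
  have flin: "linear f"
    using g(1) h(1) by (auto simp: f_def linear_iff algebra_simps add_divide_distrib)
  have fv: "f v = 1" using \<tau> g(3) by (simp add: f_def \<tau>_def)
  have habs: "\<bar>h x\<bar> \<le> M x" for x using h(2)[of x] low[of x] by simp
  have fS: "\<bar>f x\<bar> \<le> (1 - b) * M x" if "x \<in> S" for x
    using h(3)[OF that] gabs[of x] b by (simp add: f_def abs_mult)
  have fX: "\<bar>f x\<bar> \<le> (1 - b + b / \<tau>) * M x" for x
  proof -
    have "\<bar>f x\<bar> \<le> \<bar>(1 - b) * g x\<bar> + \<bar>(b / \<tau>) * h x\<bar>" unfolding f_def by (rule abs_triangle_ineq)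
    also have "\<dots> = (1 - b) * \<bar>g x\<bar> + (b / \<tau>) * \<bar>h x\<bar>" using b b\<tau> \<tau> by (simp add: abs_mult)
    also have "\<dots> \<le> (1 - b) * M x + (b / \<tau>) * M x"
      using b b\<tau> by (intro add_mono mult_left_mono gabs habs) simp_all
    finally show ?thesis by (simp add: algebra_simps)
  qed
  define c where "c = b / (2 + b / \<tau>)"
  have c: "0 < c" using b b\<tau> by (simp add: c_def)
  have proj: "c * M (x - f x *\<^sub>R v) \<le> b * M x" for x
  proof -
    have "M (x - f x *\<^sub>R v) \<le> M x + \<bar>f x\<bar>"
      using is_norm_diff[OF M, of x "f x *\<^sub>R v"] Mn(4) v(2) by simp
    also have "\<dots> \<le> M x + (1 - b + b / \<tau>) * M x" using fX by simp
    also have "\<dots> = (2 + b / \<tau>) * M x - b * M x" by (simp add: algebra_simps)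
    also have "\<dots> \<le> (2 + b / \<tau>) * M x" using b Mn(1)[of x] by simp
    finally have "c * M (x - f x *\<^sub>R v) \<le> c * ((2 + b / \<tau>) * M x)" using c by simp
    also have "\<dots> = b * M x" using b\<tau> by (simp add: c_def)
    finally show ?thesis .
  qed
  show ?thesis
  proof
    show "\<bar>f x\<bar> + c * M (x - f x *\<^sub>R v) \<le> M x" if "x \<in> S" for x
      using fS[OF that] proj[of x] by (simp add: algebra_simps)
    show "\<bar>f x\<bar> + c * M (x - f x *\<^sub>R v) \<le> r * M x" for x
    proof -
      have "(1 + b / \<tau>) * M x \<le> r * M x" using b\<tau> Mn(1) by (intro mult_right_mono) auto
      then show ?thesis using fX[of x] proj[of x] by (simp add: algebra_simps)
    qed
  qed (use flin c fv in auto)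
qed

text \<open>
  Since \<open>M\<close> itself measures the width of the cone, the cone is polyhedral too: if \<open>M\<close> is the maximum of
  the \<open>\<bar>\<phi>\<bar>\<close> on \<open>span (insert v F)\<close>, then the cone norm is the maximum of
  \<open>\<bar>f x + c * \<phi> (x - f x v)\<bar>\<close> and \<open>\<bar>f x - c * \<phi> (x - f x v)\<bar>\<close> on \<open>span F\<close>.
\<close>

lemma locally_max_of_functionals_cone:
  fixes M :: "'a::real_vector \<Rightarrow> real"
  assumes M: "locally_max_of_functionals M" and f: "linear f" and c: "0 < c"
  shows "locally_max_of_functionals (\<lambda>x. max (M x) (\<bar>f x\<bar> + c * M (x - f x *\<^sub>R v)))"
  unfolding locally_max_of_functionals_def
proof (intro allI impI)
  fix F :: "'a set" assume "finite F"
  then have "max_of_functionals_on (span (insert v F)) M"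
    using M by (simp add: locally_max_of_functionals_def)
  then obtain \<Phi> where \<Phi>: "finite \<Phi>" "\<And>\<phi>. \<phi> \<in> \<Phi> \<Longrightarrow> linear \<phi>"
    "\<And>x \<phi>. x \<in> span (insert v F) \<Longrightarrow> \<phi> \<in> \<Phi> \<Longrightarrow> \<bar>\<phi> x\<bar> \<le> M x"
    "\<And>x. x \<in> span (insert v F) \<Longrightarrow> \<exists>\<phi>\<in>\<Phi>. M x = \<bar>\<phi> x\<bar>"
    unfolding max_of_functionals_on_def by blast
  define g where "g s \<phi> x = f x + s * \<phi> (x - f x *\<^sub>R v)" for s :: real and \<phi> x
  define \<Psi> where "\<Psi> = \<Phi> \<union> g c ` \<Phi> \<union> g (- c) ` \<Phi>"
  have glin: "linear (g s \<phi>)" if "\<phi> \<in> \<Phi>" for s \<phi>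
  proof -
    have "g s \<phi> x = f x + s * (\<phi> x - f x * \<phi> v)" for x
      using \<Phi>(2)[OF that] by (simp add: g_def linear_diff linear_cmul)
    then have "g s \<phi> = (\<lambda>x. f x + s * (\<phi> x - f x * \<phi> v))" by auto
    then show ?thesis
      using f \<Phi>(2)[OF that] by (auto simp: linear_iff algebra_simps)
  qed
  let ?N = "\<lambda>x. max (M x) (\<bar>f x\<bar> + c * M (x - f x *\<^sub>R v))"
  show "max_of_functionals_on (span F) ?N"
    unfolding max_of_functionals_on_def
  proof (intro exI[of _ \<Psi>] conjI ballI)
    show "finite \<Psi>" using \<Phi>(1) by (simp add: \<Psi>_def)
    show "linear \<psi>" if "\<psi> \<in> \<Psi>" for \<psi> using that \<Phi>(2) glin by (auto simp: \<Psi>_def)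
  next
    fix x assume "x \<in> span F"
    then have x: "x \<in> span (insert v F)" using span_mono[of F "insert v F"] by auto
    moreover have "v \<in> span (insert v F)" by (simp add: span_base)
    ultimately have y: "x - f x *\<^sub>R v \<in> span (insert v F)" by (intro span_diff span_scale)
    show "\<bar>\<psi> x\<bar> \<le> ?N x" if "\<psi> \<in> \<Psi>" for \<psi>
    proof -
      have g: "\<bar>g s \<phi> x\<bar> \<le> ?N x" if "\<phi> \<in> \<Phi>" "\<bar>s\<bar> = c" for s \<phi>
      proof -
        have "\<bar>g s \<phi> x\<bar> \<le> \<bar>f x\<bar> + \<bar>s * \<phi> (x - f x *\<^sub>R v)\<bar>"
          unfolding g_def by (rule abs_triangle_ineq)
        also have "\<dots> \<le> \<bar>f x\<bar> + c * M (x - f x *\<^sub>R v)"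
          using \<Phi>(3)[OF y that(1)] that(2) c by (simp add: abs_mult)
        finally show ?thesis by simp
      qed
      consider "\<psi> \<in> \<Phi>" | \<phi> s where "\<phi> \<in> \<Phi>" "\<psi> = g s \<phi>" "\<bar>s\<bar> = c"
        using \<open>\<psi> \<in> \<Psi>\<close> c unfolding \<Psi>_def by fastforce
      then show ?thesis
      proof cases
        case 1
        then show ?thesis using \<Phi>(3)[OF x] by (simp add: max.coboundedI1)
      next
        case 2
        then show ?thesis using g by blast
      qed
    qed
    show "\<exists>\<psi>\<in>\<Psi>. ?N x = \<bar>\<psi> x\<bar>"
    proof (cases "\<bar>f x\<bar> + c * M (x - f x *\<^sub>R v) \<le> M x")
      case True
      then have "?N x = M x" by simp
      then show ?thesis using \<Phi>(4)[OF x] by (auto simp: \<Psi>_def)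
    next
      case False
      obtain \<phi> where \<phi>: "\<phi> \<in> \<Phi>" "M (x - f x *\<^sub>R v) = \<bar>\<phi> (x - f x *\<^sub>R v)\<bar>"
        using \<Phi>(4)[OF y] by blast
      have "\<bar>a\<bar> + c * \<bar>t\<bar> = \<bar>a + c * t\<bar> \<or> \<bar>a\<bar> + c * \<bar>t\<bar> = \<bar>a + (- c) * t\<bar>" for a t :: real
      proof -
        have "c * \<bar>t\<bar> = \<bar>c * t\<bar>" using c by (simp add: abs_mult)
        then show ?thesis by (simp add: abs_if split: if_splits)
      qed
      then have "?N x = \<bar>g c \<phi> x\<bar> \<or> ?N x = \<bar>g (- c) \<phi> x\<bar>"
        using False \<phi>(2) unfolding g_def by (metis max.absorb2 nle_le)
      then show ?thesis using \<phi>(1) unfolding \<Psi>_def by blast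
    qed
  qed
qed

text \<open>
  Add a small multiple of the new direction \<open>u\<close> to \<open>w\<close> and normalise.
\<close>

lemma sphere_point_off_subspace:
  fixes M :: "'a::real_vector \<Rightarrow> real"
  assumes M: "is_norm M" and u: "u \<notin> span E" and w: "w \<in> span E" and \<epsilon>: "0 < \<epsilon>"
  obtains v where "v \<in> span (insert u E)" "v \<notin> span E" "M v = 1"
    "w \<noteq> 0 \<Longrightarrow> M (v - (1 / M w) *\<^sub>R w) \<le> \<epsilon>"
proof -
  note Mn = is_normD[OF M]
  have pos: "M x > 0" if "x \<noteq> 0" for x using Mn(1,2)[of x] that by simp
  have u0: "u \<noteq> 0" using u span_zero by blast
  \<comment> \<open>for \<open>w \<noteq> 0\<close> the Lipschitz bound \<open>2 * t * M u / M w\<close> of the normalisation is then exactly \<open>\<epsilon>\<close>\<close>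
  define t where "t = (if w = 0 then 1 else \<epsilon> * M w / (2 * M u))"
  have t: "t > 0" using pos[OF u0] pos[of w] \<epsilon> by (auto simp: t_def)
  define z where "z = w + t *\<^sub>R u"
  have z: "z \<notin> span E"
  proof
    assume "z \<in> span E"
    then have "z - w \<in> span E" using w span_diff by blast
    then have "(1 / t) *\<^sub>R (z - w) \<in> span E" by (rule span_scale)
    then show False using u t by (simp add: z_def)
  qed
  then have z0: "z \<noteq> 0" using span_zero by blast
  define v where "v = (1 / M z) *\<^sub>R z"
  show ?thesis
  proof
    have "w \<in> span (insert u E)" "u \<in> span (insert u E)"
      using w span_mono[of E "insert u E"] by (auto simp: span_base)
    then show "v \<in> span (insert u E)" by (simp add: v_def z_def span_add span_scale)
    show "v \<notin> span E"
    proof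
      assume "v \<in> span E"
      then have "M z *\<^sub>R v \<in> span E" by (rule span_scale)
      then show False using z pos[OF z0] by (simp add: v_def)
    qed
    show "M v = 1" using pos[OF z0] by (simp add: v_def Mn(4))
    assume w0: "w \<noteq> 0"
    have "M (v - (1 / M w) *\<^sub>R w) \<le> 2 * M (z - w) / M w"
      unfolding v_def by (rule is_norm_normalise_lipschitz[OF M w0 z0])
    also have "M (z - w) = t * M u" using t by (simp add: z_def Mn(4))
    also have "2 * (t * M u) / M w = \<epsilon>"
      using w0 pos[OF u0] pos[OF w0] by (simp add: t_def)
    finally show "M (v - (1 / M w) *\<^sub>R w) \<le> \<epsilon>" .
  qed
qed

text \<open>
  On the unit ball, \<open>c * norm (y - f y *\<^sub>R v) \<le> 1 - f y\<close>. So \<open>f y \<rightarrow> 1\<close> forces \<open>y\<close> to approach its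
  component \<open>f y *\<^sub>R v\<close>, which tends to \<open>v\<close>.
\<close>

lemma strongly_exposed_if_cone:
  fixes N :: "'a::real_normed_vector \<Rightarrow> real"
  assumes N: "is_norm N" and C: "\<And>x. N x \<le> C * norm x"
    and v: "N v = 1" and f: "linear f" "f v = 1" and c: "0 < c"
    and cone: "\<And>x. \<bar>f x\<bar> + c * norm (x - f x *\<^sub>R v) \<le> N x"
  shows "strongly_exposed_point N (unit_ball N) v"
proof -
  have fN: "\<bar>f x\<bar> \<le> 1 * N x" for x
    using cone[of x] c by (smt (verit) mult_nonneg_nonneg norm_ge_zero)
  then have dual: "f \<in> dual_space N" using f(1) unfolding dual_space_def by blast
  have ball: "c * norm (y - f y *\<^sub>R v) \<le> 1 - f y" if "y \<in> unit_ball N" for y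
    using cone[of y] that by (simp add: unit_ball_def)
  have "f y < f v" if y: "y \<in> unit_ball N" "y \<noteq> v" for y
  proof (rule ccontr)
    assume "\<not> f y < f v"
    moreover have "f y \<le> 1" using fN[of y] y(1) by (simp add: unit_ball_def)
    ultimately have "f y = 1" using f(2) by simp
    then have "c * norm (y - v) \<le> 0" using ball[OF y(1)] by simp
    then show False using c y(2) by (simp add: mult_le_0_iff)
  qed
  moreover have "(\<lambda>n. N (y n - v)) \<longlonglongrightarrow> 0"
    if y: "\<And>n. y n \<in> unit_ball N" and lim: "(\<lambda>n. f (y n)) \<longlonglongrightarrow> f v" for y :: "nat \<Rightarrow> 'a"
  proof (rule tendsto_sandwich)
    show "\<forall>\<^sub>F n in sequentially. 0 \<le> N (y n - v)" using is_normD(1)[OF N] by simp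
    have "N (y n - v) \<le> \<bar>C\<bar> * ((1 - f (y n)) / c) + \<bar>f (y n) - 1\<bar>" for n
    proof -
      have "N (y n - v) \<le> N (y n - f (y n) *\<^sub>R v) + N ((f (y n) - 1) *\<^sub>R v)"
        using is_normD(3)[OF N, of "y n - f (y n) *\<^sub>R v" "(f (y n) - 1) *\<^sub>R v"]
        by (simp add: algebra_simps)
      also have "N ((f (y n) - 1) *\<^sub>R v) = \<bar>f (y n) - 1\<bar>" using is_normD(4)[OF N] v by simp
      also have "N (y n - f (y n) *\<^sub>R v) \<le> \<bar>C\<bar> * norm (y n - f (y n) *\<^sub>R v)"
        using C[of "y n - f (y n) *\<^sub>R v"] mult_right_mono[OF abs_ge_self[of C] norm_ge_zero]
        by (meson order_trans)
      also have "norm (y n - f (y n) *\<^sub>R v) \<le> (1 - f (y n)) / c"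
        using ball[OF y[of n]] c by (simp add: field_simps)
      finally show ?thesis by (simp add: mult_left_mono)
    qed
    then show "\<forall>\<^sub>F n in sequentially. N (y n - v) \<le> \<bar>C\<bar> * ((1 - f (y n)) / c) + \<bar>f (y n) - 1\<bar>" by simp
    have "(\<lambda>n. \<bar>C\<bar> * ((1 - f (y n)) / c) + \<bar>f (y n) - 1\<bar>) \<longlonglongrightarrow> \<bar>C\<bar> * ((1 - 1) / c) + \<bar>1 - 1\<bar>"
      using lim f(2) c by (intro tendsto_intros) auto
    then show "(\<lambda>n. \<bar>C\<bar> * ((1 - f (y n)) / c) + \<bar>f (y n) - 1\<bar>) \<longlonglongrightarrow> 0" by simp
  qed simp
  moreover have "v \<in> unit_ball N" using v by (simp add: unit_ball_def)
  ultimately show ?thesis using dual unfolding strongly_exposed_point_def by blast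
qed

text \<open>
  The exposing functional is positive at \<open>v\<close> unless \<open>v = 0\<close>, so \<open>v\<close> cannot be scaled up inside the
  ball; and \<open>0\<close> is not exposed in a nonzero space, since the ball contains \<open>y\<close> and \<open>- y\<close>.
\<close>

lemma strongly_exposed_point_in_sphere:
  fixes N :: "'a::real_normed_vector \<Rightarrow> real"
  assumes N: "is_norm N" and v: "strongly_exposed_point N (unit_ball N) v" and w: "(w::'a) \<noteq> 0"
  shows "v \<in> unit_sphere N"
proof -
  obtain f where f: "f \<in> dual_space N" "\<And>y. y \<in> unit_ball N \<Longrightarrow> y \<noteq> v \<Longrightarrow> f y < f v"
    and vB: "v \<in> unit_ball N"
    using v unfolding strongly_exposed_point_def by blast
  have lin: "linear f" using f(1) by (simp add: dual_space_def)
  have "N w > 0" using is_normD(1,2)[OF N, of w] w by simp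
  have "v \<noteq> 0"
  proof
    assume v0: "v = 0"
    define y where "y = (1 / N w) *\<^sub>R w"
    have y: "N y = 1" "N (- y) = 1" "y \<noteq> 0"
      using \<open>N w > 0\<close> w is_norm_minus[OF N] by (auto simp: y_def is_normD(4)[OF N])
    then show False
      using f(2)[of y] f(2)[of "- y"] linear_neg[OF lin, of y] linear_0[OF lin] v0
      by (simp add: unit_ball_def)
  qed
  then have pos: "N v > 0" using is_normD(1,2)[OF N, of v] by simp
  have "N v = 1"
  proof (rule ccontr)
    assume "N v \<noteq> 1"
    then have lt: "N v < 1" using vB by (simp add: unit_ball_def)
    have "(1 / N v) *\<^sub>R v \<in> unit_ball N" "0 \<in> unit_ball N"
      using pos is_normD(2)[OF N, of 0] by (auto simp: unit_ball_def is_normD(4)[OF N])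
    moreover have "(1 / N v) *\<^sub>R v \<noteq> v"
    proof
      assume "(1 / N v) *\<^sub>R v = v"
      then have "N ((1 / N v) *\<^sub>R v) = N v" by simp
      then show False using pos lt by (simp add: is_normD(4)[OF N])
    qed
    ultimately have "f ((1 / N v) *\<^sub>R v) < f v" "f 0 < f v"
      using f(2) \<open>v \<noteq> 0\<close> by metis+
    then have "f v / N v < f v" "0 < f v"
      using linear_cmul[OF lin, of "1 / N v" v] linear_0[OF lin] by simp_all
    then show False using pos lt by (simp add: field_simps)
  qed
  then show ?thesis by (simp add: unit_sphere_def)
qed

section \<open>Dense strongly exposed points\<close>

text \<open>
  The terms of the sequence are the targets to be approximated by strongly exposed points. Each
  vector is approached at arbitrarily late indices \<open>k\<close>, by which time the norm has stabilised on
  \<open>span (E k)\<close> and the permitted error is small. This is achieved by enumerating a countable dense set so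
  that every member recurs infinitely often.
\<close>

lemma recurrent_dense_sequence:
  fixes E :: "nat \<Rightarrow> 'a::real_normed_vector set"
  assumes mono: "mono (\<lambda>n. span (E n))" and fin: "\<And>n. finite (E n)"
    and cover: "\<And>x. \<exists>n. x \<in> span (E n)"
  obtains d :: "nat \<Rightarrow> 'a"
  where "\<And>x \<epsilon> m. 0 < \<epsilon> \<Longrightarrow> \<exists>k\<ge>m. d k \<in> span (E k) \<and> norm (d k - x) < \<epsilon>"
proof -
  have "\<exists>A. finite A \<and> cball 0 (real n) \<inter> span (E n) \<subseteq> (\<Union>a\<in>A. ball a (1 / (real n + 1)))" for n
  proof -
    have "seq_compact (cball 0 (real n) \<inter> span (E n))"
      using compact_cball_Int_span[OF fin] by (simp add: compact_eq_seq_compact_metric)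
    moreover have "0 < 1 / (real n + 1)" by simp
    ultimately obtain A where "finite A" "A \<subseteq> cball 0 (real n) \<inter> span (E n)"
      "cball 0 (real n) \<inter> span (E n) \<subseteq> (\<Union>a\<in>A. ball a (1 / (real n + 1)))"
      using seq_compact_imp_totally_bounded[rule_format] by metis
    then show ?thesis by blast
  qed
  then obtain A where A: "\<And>n. finite (A n)"
    "\<And>n. cball 0 (real n) \<inter> span (E n) \<subseteq> (\<Union>a\<in>A n. ball a (1 / (real n + 1)))"
    by metis
  define D where "D = (\<Union>n. A n)"
  have D: "countable D" using A(1) by (simp add: D_def countable_finite)
  define d where "d k = from_nat_into D (fst (prod_decode k))" for k
  show ?thesis
  proof
    fix x :: 'a and \<epsilon> :: real and m :: nat assume \<epsilon>: "0 < \<epsilon>"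
    obtain n1 where n1: "x \<in> span (E n1)" using cover by blast
    obtain n2 where n2: "norm x \<le> real n2" using real_arch_simple by blast
    obtain n3 where n3: "1 / (real n3 + 1) < \<epsilon>"
      using reals_Archimedean[OF \<epsilon>] by (auto simp: inverse_eq_divide add.commute)
    define n where "n = max n1 (max n2 n3)"
    have "1 / (real n + 1) \<le> 1 / (real n3 + 1)" by (intro divide_left_mono) (auto simp: n_def)
    then have n: "x \<in> cball 0 (real n) \<inter> span (E n)" "1 / (real n + 1) < \<epsilon>"
      using n1 n2 n3 monoD[OF mono, of n1 n] by (auto simp: n_def)
    then obtain a where a: "a \<in> A n" "dist a x < \<epsilon>" using A(2)[of n] by fastforce
    then have "a \<in> D" by (auto simp: D_def)
    then obtain i where i: "from_nat_into D i = a"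
      using from_nat_into_surj[OF D] by blast
    obtain l where l: "a \<in> span (E l)" using cover by blast
    define k where "k = prod_encode (i, max m l)"
    have "max m l \<le> k" unfolding k_def by (rule le_prod_encode_2)
    moreover have "d k = a" by (simp add: d_def k_def i)
    ultimately show "\<exists>k\<ge>m. d k \<in> span (E k) \<and> norm (d k - x) < \<epsilon>"
      using l a(2) monoD[OF mono, of l k] by (intro exI[of _ k]) (auto simp: dist_norm)
  qed
qed

text \<open>
  The inequality places the unit ball of \<open>N\<close> in a double cone with apices \<open>v\<close> and \<open>- v\<close>. Its width is measured by
  the fixed original norm, so that the property passes to all larger \<open>N\<close>. If moreover \<open>N v = 1\<close>, the
  point \<open>v\<close> is strongly exposed, and it remains so under every further increase of \<open>N\<close> that
  preserves its value at \<open>v\<close>.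
\<close>

definition cone_at :: "('a::real_normed_vector \<Rightarrow> real) \<Rightarrow> 'a \<Rightarrow> bool" where
  "cone_at N v \<longleftrightarrow> (\<exists>f c. linear f \<and> f v = 1 \<and> 0 < c \<and> (\<forall>x. \<bar>f x\<bar> + c * norm (x - f x *\<^sub>R v) \<le> N x))"

lemma cone_at_mono: "cone_at M v \<Longrightarrow> (\<And>x. M x \<le> N x) \<Longrightarrow> cone_at N v"
  unfolding cone_at_def by (meson order_trans)

text \<open>
  One step of the renorming. The norm is unchanged on \<open>span E\<close>, where the earlier strongly exposed
  points lie, and the new point lies in \<open>span (insert u E)\<close>, where later steps will leave
  the norm unchanged.
\<close>

lemma add_strongly_exposed_point:
  fixes M :: "'a::real_normed_vector \<Rightarrow> real"
  assumes M: "locally_max_of_functionals M" and low: "\<And>x. norm x \<le> M x"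
    and up: "\<And>x. M x \<le> C * norm x" and C: "0 < C" "C < C'"
    and E: "finite E" and u: "u \<notin> span E" and w: "w \<in> span E" and \<epsilon>: "0 < \<epsilon>"
  obtains M' v where "locally_max_of_functionals M'"
    "\<And>x. M x \<le> M' x" "\<And>x. M' x \<le> C' * norm x" "\<And>x. x \<in> span E \<Longrightarrow> M' x = M x"
    "v \<in> span (insert u E)" "M' v = 1" "cone_at M' v"
    "w \<noteq> 0 \<Longrightarrow> norm (v - (1 / M w) *\<^sub>R w) \<le> \<epsilon>"
proof -
  have Mn: "is_norm M" using is_norm_if_locally_max_of_functionals M low by blast
  obtain v where v: "v \<in> span (insert u E)" "v \<notin> span E" "M v = 1"
    "w \<noteq> 0 \<Longrightarrow> M (v - (1 / M w) *\<^sub>R w) \<le> \<epsilon>"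
    using sphere_point_off_subspace[OF Mn u w \<epsilon>] by blast
  have "1 < C' / C" using C by simp
  then obtain f c where f: "linear f" "0 < c" "f v = 1"
    "\<And>x. x \<in> span E \<Longrightarrow> \<bar>f x\<bar> + c * M (x - f x *\<^sub>R v) \<le> M x"
    "\<And>x. \<bar>f x\<bar> + c * M (x - f x *\<^sub>R v) \<le> (C' / C) * M x"
    using exposing_functional[OF Mn low subspace_span closed_span_finite[OF E] v(2,3)] by blast
  define M' where "M' x = max (M x) (\<bar>f x\<bar> + c * M (x - f x *\<^sub>R v))" for x
  show ?thesis
  proof
    show "locally_max_of_functionals M'"
      unfolding M'_def using locally_max_of_functionals_cone[OF M f(1,2)] .
    show "M x \<le> M' x" for x by (simp add: M'_def)
    show "M' x \<le> C' * norm x" for x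
    proof -
      have "(C' / C) * M x \<le> (C' / C) * (C * norm x)" using up C by (intro mult_left_mono) auto
      also have "\<dots> = C' * norm x" using C by simp
      finally have "\<bar>f x\<bar> + c * M (x - f x *\<^sub>R v) \<le> C' * norm x" using f(5)[of x] by simp
      moreover have "M x \<le> C' * norm x"
        using up[of x] C mult_right_mono[of C C' "norm x"] by simp
      ultimately show ?thesis by (simp add: M'_def)
    qed
    show "M' x = M x" if "x \<in> span E" for x using f(4)[OF that] by (simp add: M'_def)
    show "M' v = 1" using f(3) v(3) is_normD(2)[OF Mn, of 0] by (simp add: M'_def)
    have "\<bar>f x\<bar> + c * norm (x - f x *\<^sub>R v) \<le> M' x" for x
      using low[of "x - f x *\<^sub>R v"] f(2) by (simp add: M'_def max.coboundedI2)
    then show "cone_at M' v" using f(1-3) unfolding cone_at_def by blast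
    show "norm (v - (1 / M w) *\<^sub>R w) \<le> \<epsilon>" if "w \<noteq> 0"
      using v(4)[OF that] low order_trans by blast
  qed (fact v(1))
qed

lemma countable_basis_flag:
  assumes "countably_infinite_dimensional TYPE('a::real_vector)"
  obtains e :: "nat \<Rightarrow> 'a::real_vector" where "\<And>n. e n \<notin> span (e ` {..<n})"
    "\<And>x. \<exists>n. x \<in> span (e ` {..<n})" "mono (\<lambda>n. span (e ` {..<n}))"
proof -
  obtain B :: "'a set" where B: "independent B" "span B = UNIV" "countable B" "infinite B"
    using assms unfolding countably_infinite_dimensional_def by blast
  define e where "e = from_nat_into B"
  have bij: "bij_betw e UNIV B"
    unfolding e_def using B(3,4) by (rule bij_betw_from_nat_into)
  have mono: "mono (\<lambda>n. span (e ` {..<n}))"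
    by (intro monoI span_mono image_mono) auto
  show ?thesis
  proof
    fix n
    have "e ` {..<n} \<subseteq> B - {e n}"
      using bij by (auto simp: bij_betw_def inj_def)
    moreover have "e n \<notin> span (B - {e n})"
      using B(1) bij unfolding dependent_def bij_betw_def by blast
    ultimately show "e n \<notin> span (e ` {..<n})" using span_mono by blast
  next
    fix x
    have "x \<in> span (range e)" using B(2) bij by (simp add: bij_betw_def)
    then show "\<exists>n. x \<in> span (e ` {..<n})"
    proof (induction rule: span_induct_alt)
      case base
      show ?case using span_zero by blast
    next
      case (step c b y)
      then obtain n m where "b = e n" "y \<in> span (e ` {..<m})" by blast
      then have "b \<in> span (e ` {..<max (Suc n) m})" "y \<in> span (e ` {..<max (Suc n) m})"
        using monoD[OF mono, of m "max (Suc n) m"] by (auto intro: span_base)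
      then show ?case using span_add span_scale by blast
    qed
  qed (fact mono)
qed

theorem theorem5p12:
  assumes "countably_infinite_dimensional TYPE('a::real_normed_vector)"
  shows "\<exists>N :: 'a \<Rightarrow> real.
           equivalent_norm N \<and>
           polyhedral_norm N \<and>
           norm_dense_in N {x. strongly_exposed_point N (unit_ball N) x} (unit_sphere N)"
proof -
  obtain e :: "nat \<Rightarrow> 'a" where e: "\<And>n. e n \<notin> span (e ` {..<n})"
    "\<And>x. \<exists>n. x \<in> span (e ` {..<n})" "mono (\<lambda>n. span (e ` {..<n}))"
    using countable_basis_flag[OF assms] by blast
  define E where "E n = e ` {..<n}" for n
  have mono: "mono (\<lambda>n. span (E n))" and fin: "finite (E n)" and cover: "\<exists>n. x \<in> span (E n)" for n x
    using e(2,3) by (auto simp: E_def)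
  have e0: "e 0 \<noteq> 0" using e(1)[of 0] by auto
  have ESuc: "E (Suc n) = insert (e n) (E n)" for n by (auto simp: E_def lessThan_Suc)
  obtain d :: "nat \<Rightarrow> 'a" where
    d: "\<And>x \<epsilon> m. 0 < \<epsilon> \<Longrightarrow> \<exists>k\<ge>m. d k \<in> span (E k) \<and> norm (d k - x) < \<epsilon>"
    using recurrent_dense_sequence[OF mono fin cover] by blast
  \<comment> \<open>starts at the bound 2 of the first polyhedral norm, increases strictly because every step
    needs some room to increase the norm, and stays below 3\<close>
  define C :: "nat \<Rightarrow> real" where "C k = 3 - 1 / (real k + 1)" for k
  have C: "0 < C k" "C k < C (Suc k)" "C k \<le> 3" for k by (auto simp: C_def field_simps)
  define P where "P k M \<longleftrightarrow> locally_max_of_functionals M \<and> (\<forall>x. norm x \<le> M x \<and> M x \<le> C k * norm x)"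
    for k and M :: "'a \<Rightarrow> real"
  define Q where "Q k M M' \<longleftrightarrow> (\<forall>x. M x \<le> M' x) \<and> (\<forall>x\<in>span (E k). M' x = M x) \<and>
      (\<exists>v\<in>span (E (Suc k)). M' v = 1 \<and> cone_at M' v \<and>
        (d k \<in> span (E k) \<longrightarrow> d k \<noteq> 0 \<longrightarrow> norm (v - (1 / M (d k)) *\<^sub>R d k) \<le> 1 / (real k + 1)))"
    for k and M M' :: "'a \<Rightarrow> real"
  have "\<exists>G. \<forall>k. P k (G k) \<and> Q k (G k) (G (Suc k))"
  proof (rule dependent_nat_choice)
    have "C 0 = 2" by (simp add: C_def)
    then show "\<exists>M. P 0 M"
      using polyhedral_base_norm[OF mono fin cover] unfolding P_def by metis
  next
    fix M k assume "P k M"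
    then have M: "locally_max_of_functionals M" "\<And>x. norm x \<le> M x" "\<And>x. M x \<le> C k * norm x"
      by (auto simp: P_def)
    \<comment> \<open>a target that is not yet in \<open>span (E k)\<close> is skipped; it recurs later\<close>
    define w where "w = (if d k \<in> span (E k) then d k else 0)"
    have w: "w \<in> span (E k)" by (simp add: w_def span_zero)
    have u: "e k \<notin> span (E k)" using e(1) by (simp add: E_def)
    obtain M' v where M': "locally_max_of_functionals M'" "\<And>x. M x \<le> M' x"
      "\<And>x. M' x \<le> C (Suc k) * norm x" "\<And>x. x \<in> span (E k) \<Longrightarrow> M' x = M x"
      "v \<in> span (insert (e k) (E k))" "M' v = 1" "cone_at M' v"
      "w \<noteq> 0 \<Longrightarrow> norm (v - (1 / M w) *\<^sub>R w) \<le> 1 / (real k + 1)"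
      using add_strongly_exposed_point[OF M C(1,2) fin u w, of "1 / (real k + 1)"] by auto
    have "P (Suc k) M'" unfolding P_def using M'(1-3) M(2) order_trans by blast
    moreover have "Q k M M'"
      unfolding Q_def ESuc using M'(2,4-8) by (auto simp: w_def)
    ultimately show "\<exists>M'. P (Suc k) M' \<and> Q k M M'" by blast
  qed
  then obtain G where G: "\<And>k. P k (G k)" "\<And>k. Q k (G k) (G (Suc k))" by blast
  obtain N where N: "\<And>m n x. x \<in> span (E n) \<Longrightarrow> n \<le> m \<Longrightarrow> G m x = N x"
    using glue_along_exhaustion[OF mono cover, of G] G(2) unfolding Q_def by blast
  have Gmono: "G m x \<le> G n x" if "m \<le> n" for m n x
  proof (rule lift_Suc_mono_le[of "\<lambda>n. G n x", OF _ that])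
    show "G n x \<le> G (Suc n) x" for n using G(2)[of n] unfolding Q_def by blast
  qed
  have GN: "G k x \<le> N x" for k x
  proof -
    obtain n where "x \<in> span (E n)" using cover by blast
    then show ?thesis using N[of x n "max n k"] Gmono[of k "max n k" x] by simp
  qed
  have Nlow: "norm x \<le> N x" for x
    using G(1)[of 0] GN[of 0 x] unfolding P_def by (meson order_trans)
  have Nup: "N x \<le> 3 * norm x" for x
  proof -
    obtain n where "x \<in> span (E n)" using cover by blast
    then have "N x \<le> C n * norm x" using N[of x n n] G(1)[of n] unfolding P_def by (metis order_refl)
    also have "\<dots> \<le> 3 * norm x" using C(3) by (intro mult_right_mono) auto
    finally show ?thesis .
  qed
  have "max_of_functionals_on (span (E n)) N" for n
  proof (rule max_of_functionals_on_cong)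
    show "max_of_functionals_on (span (E n)) (G n)"
      using G(1)[of n] fin unfolding P_def locally_max_of_functionals_def by blast
  qed (use N in auto)
  then have Nmax: "locally_max_of_functionals N"
    using locally_max_of_functionals_glue[OF mono _ cover] by simp
  have Nnorm: "is_norm N" using is_norm_if_locally_max_of_functionals[OF Nmax Nlow] .
  have "\<exists>v. strongly_exposed_point N (unit_ball N) v \<and> N (v - x) < \<epsilon>"
    if x: "N x = 1" and \<epsilon>: "0 < \<epsilon>" for x \<epsilon>
  proof -
    have x0: "x \<noteq> 0" using x is_normD(2)[OF Nnorm, of x] by auto
    obtain m where m: "1 / (real m + 1) < \<epsilon> / 6"
      using reals_Archimedean[of "\<epsilon> / 6"] \<epsilon> by (auto simp: inverse_eq_divide add.commute)
    \<comment> \<open>\<open>v\<close> is within \<open>\<epsilon> / 6\<close> of the normalised target in the original norm, and normalising at most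
      doubles the distance \<open>\<epsilon> / 12\<close>; the factor 3 from \<open>N \<le> 3 * norm\<close> makes \<open>\<epsilon> / 2\<close> of each\<close>
    have "0 < min (norm x) (\<epsilon> / 12)" using x0 \<epsilon> by simp
    then obtain k where k: "m \<le> k" "d k \<in> span (E k)" "norm (d k - x) < min (norm x) (\<epsilon> / 12)"
      using d by blast
    have d0: "d k \<noteq> 0" using k(3) by auto
    obtain v where v: "v \<in> span (E (Suc k))" "G (Suc k) v = 1" "cone_at (G (Suc k)) v"
      "norm (v - (1 / G k (d k)) *\<^sub>R d k) \<le> 1 / (real k + 1)"
      using G(2)[of k] k(2) d0 unfolding Q_def by blast
    have Nv: "N v = 1" using N[OF v(1)] v(2) by simp
    have "cone_at N v" using cone_at_mono[OF v(3)] GN by blast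
    then have "strongly_exposed_point N (unit_ball N) v"
      unfolding cone_at_def using strongly_exposed_if_cone[OF Nnorm Nup Nv] by blast
    moreover have "N (v - x) < \<epsilon>"
    proof -
      define y where "y = (1 / N (d k)) *\<^sub>R d k"
      have Gd: "G k (d k) = N (d k)" using N[OF k(2)] by simp
      have "1 / (real k + 1) \<le> 1 / (real m + 1)" using k(1) by (intro divide_left_mono) auto
      then have "norm (v - y) < \<epsilon> / 6" using v(4) m by (simp add: Gd y_def)
      then have 1: "N (v - y) < \<epsilon> / 2" using Nup[of "v - y"] by simp
      have "N (y - (1 / N x) *\<^sub>R x) \<le> 2 * N (d k - x) / N x"
        unfolding y_def by (rule is_norm_normalise_lipschitz[OF Nnorm x0 d0])
      then have 2: "N (y - x) < \<epsilon> / 2" using x Nup[of "d k - x"] k(3) by simp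
      have "N (v - x) \<le> N (v - y) + N (y - x)"
        using is_normD(3)[OF Nnorm, of "v - y" "y - x"] by simp
      then show ?thesis using 1 2 by simp
    qed
    ultimately show ?thesis by blast
  qed
  moreover have "{v. strongly_exposed_point N (unit_ball N) v} \<subseteq> unit_sphere N"
    using strongly_exposed_point_in_sphere[OF Nnorm _ e0] by blast
  ultimately have "norm_dense_in N {v. strongly_exposed_point N (unit_ball N) v} (unit_sphere N)"
    by (auto simp: norm_dense_in_def unit_sphere_def)
  moreover have "equivalent_norm N"
    unfolding equivalent_norm_def
    using Nnorm Nlow Nup by (intro conjI exI[of _ 1] exI[of _ 3]) auto
  ultimately show ?thesis
    using polyhedral_norm_if_locally_max_of_functionals[OF Nmax Nlow] by blast
qed

end
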